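(* Let $\kappa$ be a regular uncountable cardinal and let $\lambda\ge\kappa$ be a cardinal. (i) Suppose $I$ is a $\kappa$-complete normal ideal over $\kappa$. If $\{\alpha<\kappa : \operatorname{cf}\alpha=\delta\}\notin I$ for some cardinal $\delta$ satisfying $\delta^{+}<\kappa$, then $I$ is not ``proper''. (ii) Suppose $I$ is a $\kappa$-complete normal ideal over $\mathcal{P}_\kappa\lambda$. If $\{s\in\mathcal{P}_\kappa\lambda : \operatorname{cf}(s\cap\kappa)=\delta\}\notin I$ for some cardinal $\delta$ satisfying $\delta^{+}<\kappa$, then $I$ is not ``proper''.
   Context: $\mathcal{P}_\kappa\lambda=\{s\subseteq\lambda : |s|<\kappa\}$. For an ideal $I$ over a set $A$, a subset of $A$ is $I$-positive if it is not in $I$, and $\mathbb{P}_I$ is the poset of $I$-positive subsets of $A$ ordered by $X\le Y\iff X\subseteq Y$. The ideal $I$ is called ``proper'' if $\mathbb{P}_I$ is a proper poset in the sense of Shelah's proper forcing. (This is unrelated to $I$ being a proper subset of the power set of $A$.) Conventions on ideals: an ideal over $A$ does not contain $A$ itself. It is $\kappa$-complete if it is closed under unions of fewer than $\kappa$ members. A $\kappa$-complete normal ideal over $\kappa$ is a $\kappa$-complete ideal that contains all bounded subsets of $\kappa$ and is such that every function $f$ defined on an $I$-positive set $X\subseteq\kappa$ with $f(\alpha)<\alpha$ for all $\alpha\in X\setminus\{0\}$ is constant on an $I$-positive subset of $X$. A $\kappa$-complete normal ideal over $\mathcal{P}_\kappa\lambda$ is a $\kappa$-complete ideal that contains $\{s\in\mathcal{P}_\kappa\lambda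 : \alpha\notin s\}$ for every $\alpha<\lambda$ and is such that every function $f$ defined on an $I$-positive set $X$ with $f(s)\in s$ for all $s\in X$ is constant on an $I$-positive subset of $X$. In particular such ideals contain all non-stationary sets. $\operatorname{cf}(s\cap\kappa)$ is the cofinality of the set of ordinals $s\cap\kappa$ (i.e. of its order type). *)

theory Defs
  imports Main "HOL-Library.Countable_Set"
begin

unbundle cardinal_syntax

section \<open>Ordinals, cofinality and ideals\<close>

text \<open>
  An infinite cardinal is a well-order \<open>r\<close> with \<open>Card_order r\<close>; the elements of \<open>Field r\<close> are the
  ordinals below it, and the ordinal \<open>\<alpha>\<close>, as a set of ordinals, is \<open>underS r \<alpha>\<close>.
\<close>

text \<open>
  \<open>has_cofinality r S d\<close>: the set of ordinals \<open>S\<close>, ordered by \<open>r\<close>, has cofinality \<open>d\<close>.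
  The comparison with elements of \<open>C\<close> is non-strict, so that the cofinality of a successor is 1 (the
  library constant \<^const>\<open>cofinal\<close> is strict and suits limits only).
\<close>

definition cofinal_in :: "'a rel \<Rightarrow> 'a set \<Rightarrow> 'a set \<Rightarrow> bool" where
  "cofinal_in r S C \<longleftrightarrow> C \<subseteq> S \<and> (\<forall>a\<in>S. \<exists>c\<in>C. (a, c) \<in> r)"

definition has_cofinality :: "'a rel \<Rightarrow> 'a set \<Rightarrow> 'b rel \<Rightarrow> bool" where
  "has_cofinality r S d \<longleftrightarrow>
     (\<exists>C. cofinal_in r S C \<and> |C| =o d) \<and> (\<forall>C. cofinal_in r S C \<longrightarrow> d \<le>o |C| )"

definition Pkl :: "'a rel \<Rightarrow> 'a rel \<Rightarrow> 'a set set" where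
  "Pkl k l = {s. s \<subseteq> Field l \<and> |s| <o k}"

definition ideal_over :: "'b set \<Rightarrow> 'b set set \<Rightarrow> bool" where
  "ideal_over A I \<longleftrightarrow>
     I \<subseteq> Pow A \<and> {} \<in> I \<and> (\<forall>X\<in>I. \<forall>Y. Y \<subseteq> X \<longrightarrow> Y \<in> I) \<and>
     (\<forall>X\<in>I. \<forall>Y\<in>I. X \<union> Y \<in> I) \<and> A \<notin> I"

definition complete_ideal :: "'a rel \<Rightarrow> 'b set \<Rightarrow> 'b set set \<Rightarrow> bool" where
  "complete_ideal k A I \<longleftrightarrow> ideal_over A I \<and> (\<forall>J. J \<subseteq> I \<and> |J| <o k \<longrightarrow> \<Union>J \<in> I)"

definition positive_sets :: "'b set \<Rightarrow> 'b set set \<Rightarrow> 'b set set" where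
  "positive_sets A I = {X. X \<subseteq> A \<and> X \<notin> I}"

definition normal_ideal_on_cardinal :: "'a rel \<Rightarrow> 'a set set \<Rightarrow> bool" where
  "normal_ideal_on_cardinal k I \<longleftrightarrow>
     complete_ideal k (Field k) I \<and>
     (\<forall>B. B \<subseteq> Field k \<and> (\<exists>a\<in>Field k. \<forall>b\<in>B. (b, a) \<in> k) \<longrightarrow> B \<in> I) \<and>
     (\<forall>X\<in>positive_sets (Field k) I. \<forall>f :: 'a \<Rightarrow> 'a.
        (\<forall>a\<in>X. underS k a \<noteq> {} \<longrightarrow> f a \<in> underS k a) \<longrightarrow>
        (\<exists>Y\<in>positive_sets (Field k) I. Y \<subseteq> X \<and> (\<exists>c. \<forall>a\<in>Y. f a = c)))"

definition normal_ideal_on_Pkl :: "'a rel \<Rightarrow> 'a rel \<Rightarrow> 'a set set set \<Rightarrow> bool" where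
  "normal_ideal_on_Pkl k l I \<longleftrightarrow>
     complete_ideal k (Pkl k l) I \<and>
     (\<forall>a\<in>Field l. {s \<in> Pkl k l. a \<notin> s} \<in> I) \<and>
     (\<forall>X\<in>positive_sets (Pkl k l) I. \<forall>f :: 'a set \<Rightarrow> 'a.
        (\<forall>s\<in>X. f s \<in> s) \<longrightarrow>
        (\<exists>Y\<in>positive_sets (Pkl k l) I. Y \<subseteq> X \<and> (\<exists>c. \<forall>s\<in>Y. f s = c)))"

section \<open>Stationary subsets of the set of countable subsets of X\<close>

definition ctbl_subsets :: "'x set \<Rightarrow> 'x set set" where
  "ctbl_subsets X = {x. x \<subseteq> X \<and> countable x}"

definition club :: "'x set \<Rightarrow> 'x set set \<Rightarrow> bool" where
  "club X C \<longleftrightarrow>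
     C \<subseteq> ctbl_subsets X \<and>
     (\<forall>y\<in>ctbl_subsets X. \<exists>z\<in>C. y \<subseteq> z) \<and>
     (\<forall>s :: nat \<Rightarrow> 'x set. (\<forall>n. s n \<in> C \<and> s n \<subseteq> s (Suc n)) \<longrightarrow> (\<Union>n. s n) \<in> C)"

definition stationary :: "'x set \<Rightarrow> 'x set set \<Rightarrow> bool" where
  "stationary X S \<longleftrightarrow> S \<subseteq> ctbl_subsets X \<and> (\<forall>C. club X C \<longrightarrow> S \<inter> C \<noteq> {})"

section \<open>Forcing\<close>

text \<open>
  \<open>P\<close> is the set of conditions and \<open>q \<preceq> p\<close> means that \<open>q\<close> is stronger than \<open>p\<close>.  A statement of the
  forcing language is identified with the predicate \<open>\<lambda>p. p \<tturnstile> \<phi>\<close> on conditions, and the connectives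
  follow the recursive clauses of the forcing relation.  A name for a subset of a ground model set is
  a set of pairs (element, condition).  As \<open>'x\<close> may be a product, this covers names for functions and
  for sequences of sets.  A name for a set of such subsets is a set of pairs (name, condition).
  Every object of these kinds in a generic extension has a name of this form.
\<close>

type_synonym ('x, 'p) name = "('x \<times> 'p) set"

locale forcing =
  fixes P :: "'p set"
    and le :: "'p \<Rightarrow> 'p \<Rightarrow> bool"  (infix "\<preceq>" 50)
begin

definition dense_below :: "'p \<Rightarrow> ('p \<Rightarrow> bool) \<Rightarrow> bool" where
  "dense_below p D \<longleftrightarrow> (\<forall>q\<in>P. q \<preceq> p \<longrightarrow> (\<exists>r\<in>P. r \<preceq> q \<and> D r))"

text \<open>\<open>Ground b\<close> is a statement about ground model objects that does not depend on the generic.\<close>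

definition Ground :: "bool \<Rightarrow> 'p \<Rightarrow> bool" where
  "Ground b = (\<lambda>p. b)"

definition Conj :: "('p \<Rightarrow> bool) \<Rightarrow> ('p \<Rightarrow> bool) \<Rightarrow> 'p \<Rightarrow> bool"  (infixr "\<^bold>\<and>" 35) where
  "(\<phi> \<^bold>\<and> \<psi>) = (\<lambda>p. \<phi> p \<and> \<psi> p)"

definition Imp :: "('p \<Rightarrow> bool) \<Rightarrow> ('p \<Rightarrow> bool) \<Rightarrow> 'p \<Rightarrow> bool"  (infixr "\<^bold>\<longrightarrow>" 25) where
  "(\<phi> \<^bold>\<longrightarrow> \<psi>) = (\<lambda>p. \<forall>q\<in>P. q \<preceq> p \<longrightarrow> \<phi> q \<longrightarrow> \<psi> q)"

definition All :: "('b \<Rightarrow> 'p \<Rightarrow> bool) \<Rightarrow> 'p \<Rightarrow> bool"  (binder "\<^bold>\<forall>" 10) where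
  "(\<^bold>\<forall>x. \<phi> x) = (\<lambda>p. \<forall>x. \<phi> x p)"

definition Ex :: "('b \<Rightarrow> 'p \<Rightarrow> bool) \<Rightarrow> 'p \<Rightarrow> bool"  (binder "\<^bold>\<exists>" 10) where
  "(\<^bold>\<exists>x. \<phi> x) = (\<lambda>p. dense_below p (\<lambda>q. \<exists>x. \<phi> x q))"

definition check :: "'x set \<Rightarrow> ('x, 'p) name" where
  "check x = x \<times> P"

definition Mem :: "'x \<Rightarrow> ('x, 'p) name \<Rightarrow> 'p \<Rightarrow> bool"  (infix "\<^bold>\<in>" 50) where
  "(a \<^bold>\<in> y) = (\<lambda>p. dense_below p (\<lambda>q. \<exists>r\<in>P. (a, r) \<in> y \<and> q \<preceq> r))"

definition Sub :: "('x, 'p) name \<Rightarrow> ('x, 'p) name \<Rightarrow> 'p \<Rightarrow> bool"  (infix "\<^bold>\<subseteq>" 50) where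
  "(y \<^bold>\<subseteq> z) = (\<^bold>\<forall>a. a \<^bold>\<in> y \<^bold>\<longrightarrow> a \<^bold>\<in> z)"

definition MemFam :: "('x, 'p) name \<Rightarrow> (('x, 'p) name, 'p) name \<Rightarrow> 'p \<Rightarrow> bool"  (infix "\<^bold>\<in>\<^bold>\<in>" 50) where
  "(y \<^bold>\<in>\<^bold>\<in> C) =
     (\<lambda>p. dense_below p (\<lambda>q. \<exists>z. \<exists>r\<in>P. (z, r) \<in> C \<and> q \<preceq> r \<and> (y \<^bold>\<subseteq> z) q \<and> (z \<^bold>\<subseteq> y) q))"

text \<open>Countability is witnessed by a partial function from the natural numbers whose range covers
  the set.\<close>

definition Countable :: "('x, 'p) name \<Rightarrow> 'p \<Rightarrow> bool" where
  "Countable y =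
     (\<^bold>\<exists>f :: (nat \<times> 'x, 'p) name.
        (\<^bold>\<forall>n. \<^bold>\<forall>a. \<^bold>\<forall>b. (n, a) \<^bold>\<in> f \<^bold>\<and> (n, b) \<^bold>\<in> f \<^bold>\<longrightarrow> Ground (a = b)) \<^bold>\<and>
        (\<^bold>\<forall>a. a \<^bold>\<in> y \<^bold>\<longrightarrow> (\<^bold>\<exists>n. (n, a) \<^bold>\<in> f)))"

definition CtblSubset :: "'x set \<Rightarrow> ('x, 'p) name \<Rightarrow> 'p \<Rightarrow> bool" where
  "CtblSubset X y = (y \<^bold>\<subseteq> check X \<^bold>\<and> Countable y)"

text \<open>A name \<open>s\<close> for a subset of \<open>\<omega> \<times> X\<close> serves as a name for an \<open>\<omega>\<close>-sequence of subsets of \<open>X\<close>.\<close>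

definition nth_name :: "(nat \<times> 'x, 'p) name \<Rightarrow> nat \<Rightarrow> ('x, 'p) name" where
  "nth_name s n = {(a, p). ((n, a), p) \<in> s}"

definition Union_name :: "(nat \<times> 'x, 'p) name \<Rightarrow> ('x, 'p) name" where
  "Union_name s = {(a, p). \<exists>n. ((n, a), p) \<in> s}"

definition Club :: "'x set \<Rightarrow> (('x, 'p) name, 'p) name \<Rightarrow> 'p \<Rightarrow> bool" where
  "Club X C =
     ((\<^bold>\<forall>y. y \<^bold>\<in>\<^bold>\<in> C \<^bold>\<longrightarrow> CtblSubset X y) \<^bold>\<and>
      (\<^bold>\<forall>y. CtblSubset X y \<^bold>\<longrightarrow> (\<^bold>\<exists>z. z \<^bold>\<in>\<^bold>\<in> C \<^bold>\<and> y \<^bold>\<subseteq> z)) \<^bold>\<and>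
      (\<^bold>\<forall>s. (\<^bold>\<forall>n. nth_name s n \<^bold>\<in>\<^bold>\<in> C \<^bold>\<and> nth_name s n \<^bold>\<subseteq> nth_name s (Suc n)) \<^bold>\<longrightarrow>
            Union_name s \<^bold>\<in>\<^bold>\<in> C))"

text \<open>\<open>Stationary X S\<close>: the ground model family \<open>S\<close> is stationary in the generic extension.\<close>

definition Stationary :: "'x set \<Rightarrow> 'x set set \<Rightarrow> 'p \<Rightarrow> bool" where
  "Stationary X S =
     (\<^bold>\<forall>C. Club X C \<^bold>\<longrightarrow> (\<^bold>\<exists>x. Ground (x \<in> S) \<^bold>\<and> check x \<^bold>\<in>\<^bold>\<in> C))"

end

text \<open>
  A poset is proper if forcing with it preserves the stationarity of every stationary set of
  countable subsets of \<open>X\<close>, for every uncountable \<open>X\<close>.  A definition has to fix the type of the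
  elements of \<open>X\<close>; with \<open>X :: 'p set set\<close> all cardinalities up to \<open>2\<^sup>|\<^sup>P\<^sup>|\<close> occur, and larger \<open>X\<close> would
  not change the notion: if stationarity is preserved for \<open>X = P \<union> Pow P\<close>, then for club many
  countable \<open>x \<subseteq> P \<union> Pow P\<close> every \<open>p \<in> x \<inter> P\<close> has an extension below which \<open>A \<inter> x\<close> is predense for
  each maximal antichain \<open>A \<in> x\<close> (otherwise the exceptional \<open>x\<close> that fail for one fixed \<open>p\<close> are
  stationary, but are not stationary after forcing below \<open>p\<close>); these are the generic conditions,
  and they give preservation for every \<open>X\<close>.
\<close>

definition proper_forcing :: "'p set \<Rightarrow> ('p \<Rightarrow> 'p \<Rightarrow> bool) \<Rightarrow> bool" where
  "proper_forcing P le \<longleftrightarrow>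
     (\<forall>(X :: 'p set set) S. uncountable X \<and> stationary X S \<longrightarrow>
        (\<forall>p\<in>P. forcing.Stationary P le X S p))"

definition proper_ideal :: "'b set \<Rightarrow> 'b set set \<Rightarrow> bool" where
  "proper_ideal A I \<longleftrightarrow> proper_forcing (positive_sets A I) (\<subseteq>)"

end

theory Submission
  imports Defs
begin

text \<open>
  The usual argument passes to the generic ultrapower: if the set of points of cofinality \<open>\<delta>\<close> is
  positive, it makes \<open>\<kappa>\<close> an ordinal of cofinality \<open>\<delta>\<close>, so a club of size \<open>\<delta>\<close> in \<open>\<kappa>\<close> misses one of
  any \<open>\<delta>\<^sup>+\<close> disjoint subsets of \<open>\<kappa>\<close>.  Take \<open>\<delta>\<^sup>+ < \<kappa>\<close> disjoint stationary sets of ordinals of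
  cofinality \<open>\<omega>\<close>: one of them is no longer stationary, whereas proper forcing preserves the
  stationarity of each of them.  This contradiction can be reached below a positive set fixed in
  advance, without forming the ultrapower.

  Let \<open>tr s\<close> be the subset of \<open>\<kappa>\<close> attached to a point \<open>s\<close>, which is \<open>\<alpha>\<close> itself for an ideal over
  \<open>\<kappa>\<close> and \<open>s \<inter> \<kappa>\<close> for an ideal over \<open>\<P>\<^sub>\<kappa>\<lambda>\<close>, and let \<open>B s\<close> be a cofinal subset of \<open>tr s\<close> of size
  \<open>\<delta>\<close>.  The set \<open>B s\<close> has at most \<open>\<delta>\<close> limit points (\<open>card_limit_points\<close>), so they miss some set
  \<open>S\<^sub>j\<close> of a family of \<open>\<delta>\<^sup>+\<close> disjoint stationary sets of ordinals of cofinality \<open>\<omega>\<close>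
  (\<open>ex_disjoint_stat\<close>).  By completeness \<open>j\<close> does not depend on \<open>s\<close> for \<open>s\<close> in a positive set
  \<open>Y0\<close>.  Below \<open>Y0\<close> the conditions \<open>Y\<close> with \<open>c \<in> B s\<close> for all \<open>s \<in> Y\<close> decide that \<open>c\<close> belongs to a
  generic subset \<open>D\<close> of \<open>\<kappa>\<close>.  By normality \<open>D\<close> is forced to be unbounded in \<open>\<kappa>\<close>, and by
  completeness it is forced to be bounded below every \<open>b \<in> S\<^sub>j\<close>, since no such \<open>b\<close> is a limit
  point of \<open>B s\<close> for \<open>s \<in> Y0\<close>.

  In the extension the countable \<open>x \<subseteq> \<kappa>\<close> that contain an element of \<open>D\<close> above each of their
  elements form a club (\<open>Club_closed_sets_name\<close>).  If such an \<open>x\<close> has supremum \<open>b\<close>, then \<open>D\<close> is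
  unbounded in \<open>b\<close>, and so \<open>b \<notin> S\<^sub>j\<close>.  Hence the ground model set of all countable \<open>x\<close> with
  supremum in \<open>S\<^sub>j\<close>, which is stationary in the ground model (\<open>stationary_sups_in\<close>), is not
  stationary in the extension (\<open>not_proper_ideal\<close>).
\<close>

section \<open>Clubs and stationary sets of countable subsets\<close>

lemma club_subset: "club X C \<Longrightarrow> x \<in> C \<Longrightarrow> x \<subseteq> X \<and> countable x"
  unfolding club_def ctbl_subsets_def by (drule conjunct1) blast

lemma club_above: "club X C \<Longrightarrow> y \<subseteq> X \<Longrightarrow> countable y \<Longrightarrow> \<exists>z\<in>C. y \<subseteq> z"
  unfolding club_def ctbl_subsets_def by (drule conjunct2, drule conjunct1) blast

lemma club_Union:
  "club X C \<Longrightarrow> (\<And>n. s n \<in> C) \<Longrightarrow> (\<And>n. s n \<subseteq> s (Suc n)) \<Longrightarrow> (\<Union>n::nat. s n) \<in> C"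
  unfolding club_def by simp

text \<open>
  Properness speaks of sets of sets of conditions.  This moves a stationary set of countable
  subsets of \<open>\<kappa>\<close> to such a set.
\<close>

lemma stationary_image:
  assumes e: "inj_on e X" and S: "stationary X S"
  shows "stationary (e ` X) ((`) e ` S)"
  unfolding stationary_def
proof (intro conjI allI impI)
  show "(`) e ` S \<subseteq> ctbl_subsets (e ` X)"
    using conjunct1[OF S[unfolded stationary_def]] unfolding ctbl_subsets_def by auto
  fix C assume C: "club (e ` X) C"
  define C' where "C' = {x. x \<subseteq> X \<and> e ` x \<in> C}"
  have "club X C'"
    unfolding club_def
  proof (intro conjI ballI allI impI)
    show "C' \<subseteq> ctbl_subsets X"
    proof
      fix x assume "x \<in> C'"
      then have "x \<subseteq> X" "countable (e ` x)" using club_subset[OF C] unfolding C'_def by auto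
      then show "x \<in> ctbl_subsets X"
        using countable_image_inj_on[OF _ inj_on_subset[OF e]] unfolding ctbl_subsets_def by blast
    qed
  next
    fix y assume "y \<in> ctbl_subsets X"
    then have "y \<subseteq> X" "countable y" unfolding ctbl_subsets_def by auto
    then obtain z where z: "z \<in> C" "e ` y \<subseteq> z" using club_above[OF C, of "e ` y"] by blast
    have "e ` {a \<in> X. e a \<in> z} = z" using club_subset[OF C z(1)] by blast
    then have "{a \<in> X. e a \<in> z} \<in> C'" using z(1) unfolding C'_def by simp
    moreover have "y \<subseteq> {a \<in> X. e a \<in> z}" using \<open>y \<subseteq> X\<close> z(2) by blast
    ultimately show "\<exists>z\<in>C'. y \<subseteq> z" by blast
  next
    fix s :: "nat \<Rightarrow> _" assume s: "\<forall>n. s n \<in> C' \<and> s n \<subseteq> s (Suc n)"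
    then have "e ` s n \<in> C" "e ` s n \<subseteq> e ` s (Suc n)" for n unfolding C'_def by blast+
    then have "(\<Union>n. e ` s n) \<in> C" by (rule club_Union[OF C])
    then show "(\<Union>n. s n) \<in> C'" using s unfolding C'_def by (auto simp: image_UN)
  qed
  then have "S \<inter> C' \<noteq> {}" using S unfolding stationary_def by simp
  then obtain x where "x \<in> S" "x \<in> C'" by blast
  then show "(`) e ` S \<inter> C \<noteq> {}" unfolding C'_def by blast
qed

section \<open>Forcing: the club of countable sets closed for a generic set\<close>

text \<open>
  Inclusion of positive sets is a preorder; this is all that the forcing argument has to know
  about them.  The formulas that occur below are regular open: each passes to stronger conditions,
  and it holds at a condition as soon as it holds on a dense set below.  This is what lets the
  proofs argue below an arbitrary extension and decide witnesses there.
\<close>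

locale preorder_forcing = forcing P le
  for P :: "'p set" and le :: "'p \<Rightarrow> 'p \<Rightarrow> bool"  (infix "\<preceq>" 50) +
  assumes le_refl: "p \<in> P \<Longrightarrow> p \<preceq> p"
    and le_trans: "r \<preceq> q \<Longrightarrow> q \<preceq> p \<Longrightarrow> r \<preceq> p"
begin

definition downward :: "('p \<Rightarrow> bool) \<Rightarrow> bool" where
  "downward \<phi> \<longleftrightarrow> (\<forall>p\<in>P. \<forall>q\<in>P. q \<preceq> p \<longrightarrow> \<phi> p \<longrightarrow> \<phi> q)"

definition regular_open :: "('p \<Rightarrow> bool) \<Rightarrow> bool" where
  "regular_open \<phi> \<longleftrightarrow> downward \<phi> \<and> (\<forall>p\<in>P. dense_below p \<phi> \<longrightarrow> \<phi> p)"

lemma downwardD: "downward \<phi> \<Longrightarrow> \<phi> p \<Longrightarrow> q \<preceq> p \<Longrightarrow> p \<in> P \<Longrightarrow> q \<in> P \<Longrightarrow> \<phi> q"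
  unfolding downward_def by blast

lemma regular_open_downward: "regular_open \<phi> \<Longrightarrow> downward \<phi>"
  unfolding regular_open_def by blast

lemma regular_open_mono:
  "regular_open \<phi> \<Longrightarrow> \<phi> p \<Longrightarrow> q \<preceq> p \<Longrightarrow> p \<in> P \<Longrightarrow> q \<in> P \<Longrightarrow> \<phi> q"
  by (metis downwardD regular_open_downward)

lemma regular_open_dense: "regular_open \<phi> \<Longrightarrow> p \<in> P \<Longrightarrow> dense_below p \<phi> \<Longrightarrow> \<phi> p"
  unfolding regular_open_def by blast

lemma dense_below_mono: "dense_below p \<phi> \<Longrightarrow> q \<preceq> p \<Longrightarrow> dense_below q \<phi>"
  unfolding dense_below_def by (meson le_trans)

lemma dense_belowD: "dense_below p \<phi> \<Longrightarrow> p \<in> P \<Longrightarrow> \<exists>q\<in>P. q \<preceq> p \<and> \<phi> q"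
  unfolding dense_below_def using le_refl by blast

lemma dense_below_trans:
  assumes "dense_below p \<phi>" and "\<And>q. q \<in> P \<Longrightarrow> q \<preceq> p \<Longrightarrow> \<phi> q \<Longrightarrow> dense_below q \<psi>"
  shows "dense_below p \<psi>"
  unfolding dense_below_def
proof (intro ballI impI)
  fix q assume q: "q \<in> P" "q \<preceq> p"
  then obtain r where r: "r \<in> P" "r \<preceq> q" "\<phi> r"
    using assms(1) unfolding dense_below_def by blast
  then have "dense_below r \<psi>" using assms(2) le_trans[OF r(2) q(2)] by blast
  from dense_belowD[OF this r(1)] obtain s where "s \<in> P" "s \<preceq> r" "\<psi> s" by blast
  then show "\<exists>s\<in>P. s \<preceq> q \<and> \<psi> s" using r(2) le_trans by blast
qed

lemma dense_below_weaken:
  "dense_below p \<phi> \<Longrightarrow> (\<And>q. q \<in> P \<Longrightarrow> q \<preceq> p \<Longrightarrow> \<phi> q \<Longrightarrow> \<psi> q) \<Longrightarrow> dense_below p \<psi>"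
  unfolding dense_below_def by (meson le_trans)

lemma dense_below_downward: "downward \<phi> \<Longrightarrow> p \<in> P \<Longrightarrow> \<phi> p \<Longrightarrow> dense_below p \<phi>"
  unfolding dense_below_def using downwardD le_refl by blast

lemma regular_open_dense_below: "regular_open (\<lambda>p. dense_below p \<phi>)"
  unfolding regular_open_def downward_def
  using dense_below_mono dense_below_trans by blast

lemma regular_open_Ex: "regular_open (\<^bold>\<exists>x. \<phi> x)"
  unfolding Ex_def by (rule regular_open_dense_below)

lemma regular_open_Mem: "regular_open (a \<^bold>\<in> y)"
  unfolding Mem_def by (rule regular_open_dense_below)

lemma regular_open_Ground: "regular_open (Ground b)"
  unfolding regular_open_def downward_def Ground_def using dense_belowD by blast

lemma regular_open_Conj:
  assumes "regular_open \<phi>" "regular_open \<psi>" shows "regular_open (\<phi> \<^bold>\<and> \<psi>)"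
proof -
  have "\<phi> p \<and> \<psi> p" if "p \<in> P" "dense_below p (\<lambda>p. \<phi> p \<and> \<psi> p)" for p
    using that regular_open_dense[OF assms(1)] regular_open_dense[OF assms(2)]
      dense_below_weaken by (metis (mono_tags, lifting))
  then show ?thesis
    using assms unfolding regular_open_def downward_def Conj_def by blast
qed

lemma regular_open_All: "(\<And>x. regular_open (\<phi> x)) \<Longrightarrow> regular_open (\<^bold>\<forall>x. \<phi> x)"
proof -
  assume *: "\<And>x. regular_open (\<phi> x)"
  have "\<phi> x p" if "p \<in> P" "dense_below p (\<lambda>p. \<forall>x. \<phi> x p)" for p x
    using that regular_open_dense[OF *] dense_below_weaken by (metis (mono_tags, lifting))
  then show ?thesis
    using * unfolding regular_open_def downward_def All_def by blast
qed

lemma regular_open_Imp: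
  assumes "downward \<phi>" "regular_open \<psi>" shows "regular_open (\<phi> \<^bold>\<longrightarrow> \<psi>)"
  unfolding regular_open_def downward_def Imp_def
proof (intro conjI ballI impI)
  fix p q assume p: "p \<in> P" "dense_below p (\<lambda>p. \<forall>q\<in>P. q \<preceq> p \<longrightarrow> \<phi> q \<longrightarrow> \<psi> q)"
    and q: "q \<in> P" "q \<preceq> p" "\<phi> q"
  have "dense_below q \<psi>"
    using dense_below_mono[OF p(2) q(2)]
  proof (rule dense_below_weaken)
    fix r assume "r \<in> P" "r \<preceq> q" "\<forall>q\<in>P. q \<preceq> r \<longrightarrow> \<phi> q \<longrightarrow> \<psi> q"
    then show "\<psi> r" using downwardD[OF assms(1) q(3)] q(1) le_refl by blast
  qed
  then show "\<psi> q" using regular_open_dense[OF assms(2) q(1)] by blast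
qed (use le_trans in blast)

lemma regular_open_Sub: "regular_open (y \<^bold>\<subseteq> z)"
  unfolding Sub_def
  by (intro regular_open_All regular_open_Imp regular_open_downward regular_open_Mem)

lemma regular_open_CtblSubset: "regular_open (CtblSubset X y)"
  unfolding CtblSubset_def Countable_def
  by (intro regular_open_Conj regular_open_Sub regular_open_Ex)

lemma SubD:
  "(y \<^bold>\<subseteq> z) p \<Longrightarrow> (a \<^bold>\<in> y) q \<Longrightarrow> q \<preceq> p \<Longrightarrow> q \<in> P \<Longrightarrow> (a \<^bold>\<in> z) q"
  unfolding Sub_def All_def Imp_def by blast

lemma SubI:
  "(\<And>a q. q \<in> P \<Longrightarrow> q \<preceq> p \<Longrightarrow> (a \<^bold>\<in> y) q \<Longrightarrow> (a \<^bold>\<in> z) q) \<Longrightarrow> (y \<^bold>\<subseteq> z) p"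
  unfolding Sub_def All_def Imp_def by blast

lemma Mem_check: "p \<in> P \<Longrightarrow> (a \<^bold>\<in> check X) p \<longleftrightarrow> a \<in> X"
  unfolding Mem_def check_def dense_below_def using le_refl by blast

text \<open>
  Names are most conveniently given by a downward closed relation between elements and conditions;
  membership in the name is then the regular open hull of the relation.
\<close>

definition to_name :: "('x \<Rightarrow> 'p \<Rightarrow> bool) \<Rightarrow> ('x, 'p) name" where
  "to_name Q = {(a, p). p \<in> P \<and> Q a p}"

lemma Mem_to_name:
  assumes *: "downward (Q a)"
  shows "(a \<^bold>\<in> to_name Q) p \<longleftrightarrow> dense_below p (Q a)"
proof
  assume "(a \<^bold>\<in> to_name Q) p"
  then show "dense_below p (Q a)"
    unfolding Mem_def by (elim dense_below_weaken) (auto simp: to_name_def intro: downwardD[OF *])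
next
  assume "dense_below p (Q a)"
  then show "(a \<^bold>\<in> to_name Q) p"
    unfolding Mem_def by (rule dense_below_weaken) (auto simp: to_name_def intro: le_refl)
qed

lemma Mem_to_nameI: "downward (Q a) \<Longrightarrow> p \<in> P \<Longrightarrow> Q a p \<Longrightarrow> (a \<^bold>\<in> to_name Q) p"
  by (simp only: Mem_to_name dense_below_downward)

text \<open>
  An existential statement holds when witnesses exist densely, with different witnesses below
  different conditions.  A witness is accepted here only where no extension admits an earlier one,
  along a fixed well-order of all candidates.  Accepted witnesses still exist densely, and each
  condition accepts at most one, so that they can be glued together to a single name.  This
  replaces the choice along a maximal antichain.
\<close>

definition first_witness :: "('i \<Rightarrow> 'p \<Rightarrow> bool) \<Rightarrow> 'i \<Rightarrow> 'p \<Rightarrow> bool" where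
  "first_witness Q i p \<longleftrightarrow>
     Q i p \<and> (\<forall>j. (j, i) \<in> (SOME W. well_order_on UNIV W) - Id \<longrightarrow> (\<forall>q\<in>P. q \<preceq> p \<longrightarrow> \<not> Q j q))"

lemma first_witnessD: "first_witness Q i p \<Longrightarrow> Q i p"
  unfolding first_witness_def by blast

lemma downward_first_witness: "downward (Q i) \<Longrightarrow> downward (first_witness Q i)"
  unfolding downward_def first_witness_def using le_trans by blast

lemma
  fixes Q :: "'i \<Rightarrow> 'p \<Rightarrow> bool"
  assumes p: "p \<in> P"
  shows first_witness_unique: "first_witness Q i p \<Longrightarrow> first_witness Q j p \<Longrightarrow> i = j"
    and ex_first_witness: "Q i p \<Longrightarrow> \<exists>q\<in>P. q \<preceq> p \<and> (\<exists>j. first_witness Q j q)"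
proof -
  define W where "W = (SOME W :: 'i rel. well_order_on UNIV W)"
  have "well_order_on UNIV W" unfolding W_def by (rule someI_ex) (rule well_order_on)
  then have wf: "wf (W - Id)" and tot: "\<And>i j. i \<noteq> j \<Longrightarrow> (i, j) \<in> W - Id \<or> (j, i) \<in> W - Id"
    unfolding well_order_on_def linear_order_on_def total_on_def by blast+
  note fw = first_witness_def[of Q, folded W_def]
  show "i = j" if "first_witness Q i p" "first_witness Q j p"
    using that tot le_refl[OF p] p unfolding fw by blast
  show "\<exists>q\<in>P. q \<preceq> p \<and> (\<exists>j. first_witness Q j q)" if Q: "Q i p"
  proof -
    have *: "i \<in> {j. \<exists>q\<in>P. q \<preceq> p \<and> Q j q}" using Q p le_refl by blast
    obtain j where j: "j \<in> {j. \<exists>q\<in>P. q \<preceq> p \<and> Q j q}"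
      and min: "\<And>j'. (j', j) \<in> W - Id \<Longrightarrow> j' \<notin> {j. \<exists>q\<in>P. q \<preceq> p \<and> Q j q}"
      by (rule wfE_min[OF wf *]) blast
    then obtain q where q: "q \<in> P" "q \<preceq> p" "Q j q" by blast
    then have "first_witness Q j q" unfolding fw using min le_trans by blast
    then show ?thesis using q by blast
  qed
qed

text \<open>
  The matrix of the definition of \<open>Countable\<close>, kept apart so that witnesses can be named.
\<close>

definition Enumerates :: "(nat \<times> 'x, 'p) name \<Rightarrow> ('x, 'p) name \<Rightarrow> 'p \<Rightarrow> bool" where
  "Enumerates f y =
     ((\<^bold>\<forall>n. \<^bold>\<forall>a. \<^bold>\<forall>b. (n, a) \<^bold>\<in> f \<^bold>\<and> (n, b) \<^bold>\<in> f \<^bold>\<longrightarrow> Ground (a = b)) \<^bold>\<and>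
      (\<^bold>\<forall>a. a \<^bold>\<in> y \<^bold>\<longrightarrow> (\<^bold>\<exists>n. (n, a) \<^bold>\<in> f)))"

lemma Countable_iff: "Countable y p \<longleftrightarrow> dense_below p (\<lambda>q. \<exists>f. Enumerates f y q)"
  unfolding Countable_def Enumerates_def Ex_def ..

lemma regular_open_Enumerates: "regular_open (Enumerates f y)"
  unfolding Enumerates_def
  by (intro regular_open_Conj regular_open_All regular_open_Imp regular_open_downward
      regular_open_Mem regular_open_Ex regular_open_Ground)

lemma Enumerates_iff:
  "Enumerates f y p \<longleftrightarrow>
     (\<forall>n a b. \<forall>q\<in>P. q \<preceq> p \<longrightarrow> ((n, a) \<^bold>\<in> f) q \<longrightarrow> ((n, b) \<^bold>\<in> f) q \<longrightarrow> a = b) \<and>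
     (\<forall>a. \<forall>q\<in>P. q \<preceq> p \<longrightarrow> (a \<^bold>\<in> y) q \<longrightarrow> dense_below q (\<lambda>r. \<exists>n. ((n, a) \<^bold>\<in> f) r))"
  unfolding Enumerates_def Conj_def All_def Imp_def Ground_def Ex_def by blast

lemma CountableI: "Enumerates f y p \<Longrightarrow> p \<in> P \<Longrightarrow> Countable y p"
  unfolding Countable_iff dense_below_def
  using regular_open_mono[OF regular_open_Enumerates] le_refl by blast

lemma Enumerates_to_name:
  assumes "\<And>x. downward (F x)"
    and "\<And>n a b q. q \<in> P \<Longrightarrow> q \<preceq> p \<Longrightarrow> F (n, a) q \<Longrightarrow> F (n, b) q \<Longrightarrow> a = b"
    and "\<And>a q. q \<in> P \<Longrightarrow> q \<preceq> p \<Longrightarrow> (a \<^bold>\<in> y) q \<Longrightarrow> dense_below q (\<lambda>r. \<exists>n. F (n, a) r)"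
  shows "Enumerates (to_name F) y p"
  unfolding Enumerates_iff
proof (intro conjI allI ballI impI)
  fix n a b q assume q: "q \<in> P" "q \<preceq> p" "((n, a) \<^bold>\<in> to_name F) q" "((n, b) \<^bold>\<in> to_name F) q"
  then have d: "dense_below q (F (n, a))" "dense_below q (F (n, b))"
    by (simp_all add: Mem_to_name[of F, OF assms(1)])
  obtain r where r: "r \<in> P" "r \<preceq> q" "F (n, a) r" using dense_belowD[OF d(1) q(1)] by blast
  obtain s where s: "s \<in> P" "s \<preceq> r" "F (n, b) s"
    using dense_belowD[OF dense_below_mono[OF d(2) r(2)] r(1)] by blast
  have "F (n, a) s" using downwardD[OF assms(1) r(3) s(2) r(1) s(1)] .
  then show "a = b" using assms(2)[OF s(1) le_trans[OF s(2) le_trans[OF r(2) q(2)]]] s(3) by blast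
next
  fix a q assume q: "q \<in> P" "q \<preceq> p" "(a \<^bold>\<in> y) q"
  show "dense_below q (\<lambda>r. \<exists>n. ((n, a) \<^bold>\<in> to_name F) r)"
    using assms(3)[OF q] by (rule dense_below_weaken) (use Mem_to_nameI[of F, OF assms(1)] in blast)
qed

text \<open>
  The maximum principle for countability: the enumerations that exist densely below \<open>p\<close> are glued
  along \<open>first_witness\<close>.  A single name is needed wherever infinitely many enumerations are
  combined.
\<close>

lemma Countable_imp_Enumerates:
  fixes y :: "('x, 'p) name"
  assumes p: "p \<in> P" "Countable y p"
  obtains f where "Enumerates f y p"
proof -
  define E where "E = first_witness (\<lambda>f. Enumerates f y)"
  have E: "\<And>f. downward (E f)" "\<And>f q. E f q \<Longrightarrow> Enumerates f y q"
    "\<And>f g q. q \<in> P \<Longrightarrow> E f q \<Longrightarrow> E g q \<Longrightarrow> f = g"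
    "\<And>f q. q \<in> P \<Longrightarrow> Enumerates f y q \<Longrightarrow> \<exists>r\<in>P. r \<preceq> q \<and> (\<exists>g. E g r)"
    unfolding E_def
    by (rule downward_first_witness, rule regular_open_downward, rule regular_open_Enumerates,
        erule first_witnessD, erule (2) first_witness_unique, erule (1) ex_first_witness)
  define F where "F x q \<longleftrightarrow> (\<exists>f. E f q \<and> (x \<^bold>\<in> f) q)" for x q
  have "Enumerates (to_name F) y p"
  proof (rule Enumerates_to_name)
    show "downward (F x)" for x
      using E(1) regular_open_downward[OF regular_open_Mem, of x] unfolding downward_def F_def by blast
    show "a = b" if q: "q \<in> P" "q \<preceq> p" "F (n, a) q" "F (n, b) q" for n a b q
    proof -
      obtain f g where fg: "E f q" "((n, a) \<^bold>\<in> f) q" "E g q" "((n, b) \<^bold>\<in> g) q"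
        using q(3,4) unfolding F_def by blast
      have "g = f" using E(3)[OF q(1) fg(3,1)] .
      then show ?thesis
        using E(2)[OF fg(1)] fg le_refl[OF q(1)] q(1) unfolding Enumerates_iff by blast
    qed
    show "dense_below q (\<lambda>r. \<exists>n. F (n, a) r)" if q: "q \<in> P" "q \<preceq> p" "(a \<^bold>\<in> y) q" for a q
    proof -
      have "dense_below q (\<lambda>r. \<exists>f. Enumerates f y r)"
        by (rule dense_below_mono[OF _ q(2)]) (use p(2) in \<open>simp add: Countable_iff\<close>)
      then have "dense_below q (\<lambda>r. \<exists>f. E f r)"
      proof (rule dense_below_trans)
        fix r assume r: "r \<in> P" "r \<preceq> q" "\<exists>f. Enumerates f y r"
        then obtain f where f: "Enumerates f y r" by blast
        show "dense_below r (\<lambda>r. \<exists>f. E f r)"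
          unfolding dense_below_def
        proof (intro ballI impI)
          fix t assume t: "t \<in> P" "t \<preceq> r"
          show "\<exists>u\<in>P. u \<preceq> t \<and> (\<exists>f. E f u)"
            by (rule E(4)[OF t(1)]) (rule regular_open_mono[OF regular_open_Enumerates f t(2) r(1) t(1)])
        qed
      qed
      then show ?thesis
      proof (rule dense_below_trans)
        fix r assume r: "r \<in> P" "r \<preceq> q" "\<exists>f. E f r"
        then obtain f where f: "E f r" by blast
        have "(a \<^bold>\<in> y) r" by (rule regular_open_mono[OF regular_open_Mem q(3) r(2) q(1) r(1)])
        then have "dense_below r (\<lambda>r. \<exists>n. ((n, a) \<^bold>\<in> f) r)"
          using E(2)[OF f] r(1) le_refl[OF r(1)] unfolding Enumerates_iff by blast
        then show "dense_below r (\<lambda>r. \<exists>n. F (n, a) r)"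
          by (rule dense_below_weaken) (use downwardD[OF E(1) f _ r(1)] in \<open>auto simp: F_def\<close>)
      qed
    qed
  qed
  then show thesis by (rule that)
qed

lemma CtblSubsetI:
  "p \<in> P \<Longrightarrow> Enumerates f y p \<Longrightarrow> (y \<^bold>\<subseteq> check X) p \<Longrightarrow> CtblSubset X y p"
  by (simp add: CtblSubset_def Conj_def CountableI)

lemma CtblSubset_subset:
  assumes "p \<in> P" "(y \<^bold>\<subseteq> z) p" "CtblSubset X z p" shows "CtblSubset X y p"
proof -
  have z: "(z \<^bold>\<subseteq> check X) p" "Countable z p" using assms(3) unfolding CtblSubset_def Conj_def by auto
  obtain f where f: "Enumerates f z p" using Countable_imp_Enumerates[OF assms(1) z(2)] .
  have "Enumerates f y p"
    using f SubD[OF assms(2)] unfolding Enumerates_iff by blast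
  moreover have "(y \<^bold>\<subseteq> check X) p"
    by (rule SubI) (use SubD[OF assms(2)] SubD[OF z(1)] in blast)
  ultimately show ?thesis using CtblSubsetI[OF assms(1)] by blast
qed

lemma dense_below_Union_name:
  assumes "(a \<^bold>\<in> Union_name s) q"
  shows "dense_below q (\<lambda>r. \<exists>n. (a \<^bold>\<in> nth_name s n) r)"
  using assms[unfolded Mem_def]
proof (rule dense_below_weaken)
  fix r assume r: "r \<in> P" "\<exists>t\<in>P. (a, t) \<in> Union_name s \<and> r \<preceq> t"
  then obtain t n where "t \<in> P" "(a, t) \<in> nth_name s n" "r \<preceq> t"
    unfolding Union_name_def nth_name_def by blast
  then show "\<exists>n. (a \<^bold>\<in> nth_name s n) r"
    unfolding Mem_def dense_below_def by (meson le_refl le_trans)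
qed

text \<open>
  A countable union of countable sets in the extension is countable: the maximum principle selects
  one enumeration name for each index, and the pairing function combines them.
\<close>

lemma CtblSubset_Union_name:
  fixes s :: "(nat \<times> 'x, 'p) name"
  assumes p: "p \<in> P" and s: "\<And>n. CtblSubset X (nth_name s n) p"
  shows "CtblSubset X (Union_name s) p"
proof -
  have "\<exists>f. Enumerates f (nth_name s n) p" for n
    using s[of n] Countable_imp_Enumerates[OF p] unfolding CtblSubset_def Conj_def by metis
  then obtain f where f: "\<And>n. Enumerates (f n) (nth_name s n) p" by metis
  define F where "F x q \<longleftrightarrow> ((snd (prod_decode (fst x)), snd x) \<^bold>\<in> f (fst (prod_decode (fst x)))) q"
    for x :: "nat \<times> 'x" and q
  have "Enumerates (to_name F) (Union_name s) p"
  proof (rule Enumerates_to_name)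
    show "downward (F x)" for x
      unfolding F_def by (rule regular_open_downward[OF regular_open_Mem])
    show "a = b" if "q \<in> P" "q \<preceq> p" "F (n, a) q" "F (n, b) q" for n a b q
      using that f unfolding F_def Enumerates_iff fst_conv snd_conv by blast
    show "dense_below q (\<lambda>r. \<exists>n. F (n, a) r)" if q: "q \<in> P" "q \<preceq> p" "(a \<^bold>\<in> Union_name s) q" for a q
      using dense_below_Union_name[OF q(3)]
    proof (rule dense_below_trans)
      fix r assume r: "r \<in> P" "r \<preceq> q" "\<exists>n. (a \<^bold>\<in> nth_name s n) r"
      then obtain n where "(a \<^bold>\<in> nth_name s n) r" by blast
      then have *: "dense_below r (\<lambda>t. \<exists>m. ((m, a) \<^bold>\<in> f n) t)"
        using f[of n] le_trans[OF r(2) q(2)] r(1) unfolding Enumerates_iff by blast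
      have "F (prod_encode (n, m), a) t" if "((m, a) \<^bold>\<in> f n) t" for m t
        using that unfolding F_def by simp
      with * show "dense_below r (\<lambda>r. \<exists>n. F (n, a) r)"
        by (elim dense_below_weaken) blast
    qed
  qed
  moreover have "(Union_name s \<^bold>\<subseteq> check X) p"
  proof (rule SubI)
    fix a q assume q: "q \<in> P" "q \<preceq> p" "(a \<^bold>\<in> Union_name s) q"
    then obtain r n where r: "r \<in> P" "r \<preceq> q" "(a \<^bold>\<in> nth_name s n) r"
      using dense_belowD[OF dense_below_Union_name[OF q(3)] q(1)] by blast
    have "(nth_name s n \<^bold>\<subseteq> check X) p"
      using s[of n] unfolding CtblSubset_def Conj_def by blast
    then have "(a \<^bold>\<in> check X) r" using SubD[OF _ r(3)] r(1) le_trans[OF r(2) q(2)] by blast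
    then show "(a \<^bold>\<in> check X) q" using r(1) q(1) by (simp add: Mem_check)
  qed
  ultimately show ?thesis using CtblSubsetI[OF p] by blast
qed

text \<open>
  In the application \<open>R\<close> is the strict order of \<open>\<kappa>\<close> and \<open>c\<close> the generic set, and the formula says
  that \<open>z\<close> has no largest element and that \<open>c \<inter> z\<close> is cofinal in \<open>z\<close>.
\<close>

definition Closed_for :: "('x \<Rightarrow> 'x \<Rightarrow> bool) \<Rightarrow> ('x, 'p) name \<Rightarrow> ('x, 'p) name \<Rightarrow> 'p \<Rightarrow> bool" where
  "Closed_for R c z = (\<^bold>\<forall>b. b \<^bold>\<in> z \<^bold>\<longrightarrow> (\<^bold>\<exists>a. Ground (R b a) \<^bold>\<and> a \<^bold>\<in> c \<^bold>\<and> a \<^bold>\<in> z))"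

lemma regular_open_Closed_for: "regular_open (Closed_for R c z)"
  unfolding Closed_for_def
  by (intro regular_open_All regular_open_Imp regular_open_downward regular_open_Mem regular_open_Ex)

lemma Closed_for_iff:
  "Closed_for R c z p \<longleftrightarrow>
     (\<forall>b. \<forall>q\<in>P. q \<preceq> p \<longrightarrow> (b \<^bold>\<in> z) q \<longrightarrow> dense_below q (\<lambda>r. \<exists>a. R b a \<and> (a \<^bold>\<in> c) r \<and> (a \<^bold>\<in> z) r))"
  unfolding Closed_for_def All_def Imp_def Ex_def Conj_def Ground_def ..

lemma Closed_for_eq:
  assumes "p \<in> P" "(y \<^bold>\<subseteq> z) p" "(z \<^bold>\<subseteq> y) p" "Closed_for R c z p" shows "Closed_for R c y p"
  unfolding Closed_for_iff
proof (intro allI ballI impI)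
  fix b q assume q: "q \<in> P" "q \<preceq> p" "(b \<^bold>\<in> y) q"
  then have "(b \<^bold>\<in> z) q" using SubD[OF assms(2)] by blast
  then have "dense_below q (\<lambda>r. \<exists>a. R b a \<and> (a \<^bold>\<in> c) r \<and> (a \<^bold>\<in> z) r)"
    using assms(4) q unfolding Closed_for_iff by blast
  then show "dense_below q (\<lambda>r. \<exists>a. R b a \<and> (a \<^bold>\<in> c) r \<and> (a \<^bold>\<in> y) r)"
    by (rule dense_below_weaken) (use SubD[OF assms(3)] le_trans q in blast)
qed

lemma Union_name_upper: "(nth_name s n \<^bold>\<subseteq> Union_name s) p"
  by (rule SubI) (unfold Mem_def, erule dense_below_weaken, unfold nth_name_def Union_name_def, blast)

lemma Mem_Union_name: "q \<in> P \<Longrightarrow> (a \<^bold>\<in> nth_name s n) q \<Longrightarrow> (a \<^bold>\<in> Union_name s) q"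
  by (rule SubD[OF Union_name_upper _ le_refl])

lemma Closed_for_Union_name:
  assumes "\<And>n. Closed_for R c (nth_name s n) p" shows "Closed_for R c (Union_name s) p"
  unfolding Closed_for_iff
proof (intro allI ballI impI)
  fix b q assume q: "q \<in> P" "q \<preceq> p" "(b \<^bold>\<in> Union_name s) q"
  show "dense_below q (\<lambda>r. \<exists>a. R b a \<and> (a \<^bold>\<in> c) r \<and> (a \<^bold>\<in> Union_name s) r)"
    using dense_below_Union_name[OF q(3)]
  proof (rule dense_below_trans)
    fix r assume r: "r \<in> P" "r \<preceq> q" "\<exists>n. (b \<^bold>\<in> nth_name s n) r"
    then obtain n where "(b \<^bold>\<in> nth_name s n) r" by blast
    then have "dense_below r (\<lambda>r. \<exists>a. R b a \<and> (a \<^bold>\<in> c) r \<and> (a \<^bold>\<in> nth_name s n) r)"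
      using assms[of n] le_trans[OF r(2) q(2)] r(1) unfolding Closed_for_iff by blast
    then show "dense_below r (\<lambda>r. \<exists>a. R b a \<and> (a \<^bold>\<in> c) r \<and> (a \<^bold>\<in> Union_name s) r)"
      by (rule dense_below_weaken) (auto intro: Mem_Union_name)
  qed
qed

text \<open>
  \<open>orbit G F m n a p\<close>: at the condition \<open>p\<close>, the point \<open>a\<close> is reached in \<open>n\<close> steps of the generic
  function \<open>G\<close> from the \<open>m\<close>-th point of the generic enumeration \<open>F\<close>.
\<close>

inductive orbit :: "('x \<Rightarrow> 'x \<Rightarrow> 'p \<Rightarrow> bool) \<Rightarrow> (nat \<Rightarrow> 'x \<Rightarrow> 'p \<Rightarrow> bool) \<Rightarrow> nat \<Rightarrow> nat \<Rightarrow> 'x \<Rightarrow> 'p \<Rightarrow> bool"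
  for G F where
  orbit_0: "F m a p \<Longrightarrow> orbit G F m 0 a p"
| orbit_Suc: "orbit G F m n b p \<Longrightarrow> G b a p \<Longrightarrow> orbit G F m (Suc n) a p"

inductive_cases orbit_0E: "orbit G F m 0 a p"
inductive_cases orbit_SucE: "orbit G F m (Suc n) a p"

lemma orbit_mono:
  assumes "\<And>a b. downward (G a b)" "\<And>m a. downward (F m a)" 
    and "orbit G F m n a p" "q \<preceq> p" "p \<in> P" "q \<in> P"
  shows "orbit G F m n a q"
  using assms(3-)
  by induction (use assms(1,2)[THEN downwardD] orbit.intros in metis)+

lemma orbit_unique:
  assumes "\<And>m a b. F m a p \<Longrightarrow> F m b p \<Longrightarrow> a = b" "\<And>a b c. G a b p \<Longrightarrow> G a c p \<Longrightarrow> b = c"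
    and "orbit G F m n a p" "orbit G F m n b p"
  shows "a = b"
  using assms(3,4)
proof (induction n arbitrary: a b)
  case 0 then show ?case using assms(1) by (metis orbit_0E)
next
  case (Suc n) then show ?case using assms(2) by (metis orbit_SucE)
qed

text \<open>
  The closure of \<open>y\<close> under a generic function that picks a suitable \<open>a\<close> for each \<open>b\<close>.  It is
  countable since each of its points is coded by the index of a starting point in \<open>y\<close> and a number
  of steps.
\<close>

lemma CtblSubset_closure:
  fixes y :: "('x, 'p) name"
  assumes p: "p \<in> P" and y: "CtblSubset X y p"
    and unb: "\<And>b q. b \<in> X \<Longrightarrow> q \<in> P \<Longrightarrow> q \<preceq> p \<Longrightarrow> \<exists>r\<in>P. r \<preceq> q \<and> (\<exists>a\<in>X. R b a \<and> (a \<^bold>\<in> c) r)"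
  obtains z where "CtblSubset X z p" "Closed_for R c z p" "(y \<^bold>\<subseteq> z) p"
proof -
  have yX: "(y \<^bold>\<subseteq> check X) p" using y unfolding CtblSubset_def Conj_def by blast
  obtain f where f: "Enumerates f y p"
    using y Countable_imp_Enumerates[OF p] unfolding CtblSubset_def Conj_def by blast
  define N where "N b a q \<longleftrightarrow> a \<in> X \<and> R b a \<and> (a \<^bold>\<in> c) q" for b a q
  define G where "G b = first_witness (N b)" for b
  have N: "downward (N b a)" for b a
    using regular_open_downward[OF regular_open_Mem, of a c] unfolding downward_def N_def by blast
  have G: "\<And>b a. downward (G b a)"
      "\<And>b a q. G b a q \<Longrightarrow> N b a q"
      "\<And>b a a' q. q \<in> P \<Longrightarrow> G b a q \<Longrightarrow> G b a' q \<Longrightarrow> a = a'"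
      "\<And>b a q. q \<in> P \<Longrightarrow> N b a q \<Longrightarrow> \<exists>r\<in>P. r \<preceq> q \<and> (\<exists>a. G b a r)"
    unfolding G_def
    by (rule downward_first_witness, rule N, erule first_witnessD, erule (2) first_witness_unique,
        erule (1) ex_first_witness)
  have Gdense: "dense_below q (\<lambda>r. \<exists>a. G b a r)" if "b \<in> X" "q \<preceq> p" for b q
    unfolding dense_below_def
  proof (intro ballI impI)
    fix r assume r: "r \<in> P" "r \<preceq> q"
    have "r \<preceq> p" using le_trans[OF r(2) that(2)] .
    from unb[OF that(1) r(1) this] obtain s a where s: "s \<in> P" "s \<preceq> r" "N b a s"
      unfolding N_def by blast
    with G(4)[OF s(1,3)] show "\<exists>t\<in>P. t \<preceq> r \<and> (\<exists>a. G b a t)" using le_trans by blast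
  qed
  \<comment> \<open>\<open>f\<close> may enumerate more than \<open>y\<close>; points outside \<open>X\<close> are dropped\<close>
  define F where "F m a q \<longleftrightarrow> a \<in> X \<and> ((m, a) \<^bold>\<in> f) q" for m a q
  have F: "downward (F m a)" for m a
    using regular_open_downward[OF regular_open_Mem] unfolding F_def downward_def by metis
  have Funique: "a = b" if "q \<in> P" "q \<preceq> p" "F m a q" "F m b q" for m a b q
    using f that unfolding F_def Enumerates_iff by blast
  note orbit_mono = orbit_mono[of G F, OF G(1) F]
  \<comment> \<open>the closure, as the union of all orbits\<close>
  define Z where "Z a q \<longleftrightarrow> (\<exists>m n. orbit G F m n a q)" for a q
  define z where "z = to_name Z"
  have Z: "downward (Z a)" for a
    unfolding downward_def Z_def using orbit_mono by blast
  have ZX: "a \<in> X" if "Z a q" for a q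
  proof -
    from that obtain m n where "orbit G F m n a q" unfolding Z_def by blast
    then show ?thesis by cases (use F_def G(2) N_def in blast)+
  qed
  \<comment> \<open>the pair of starting index and number of steps, coded as one number\<close>
  define E where "E x q \<longleftrightarrow> orbit G F (fst (prod_decode (fst x))) (snd (prod_decode (fst x))) (snd x) q"
    for x :: "nat \<times> 'x" and q
  have "Enumerates (to_name E) z p"
  proof (rule Enumerates_to_name)
    show "downward (E x)" for x unfolding downward_def E_def using orbit_mono by blast
    show "a = b" if "q \<in> P" "q \<preceq> p" "E (n, a) q" "E (n, b) q" for n a b q
      using that orbit_unique[of F q G] Funique G(3) unfolding E_def fst_conv snd_conv by metis
    show "dense_below q (\<lambda>r. \<exists>n. E (n, a) r)" if "(a \<^bold>\<in> z) q" for a q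
    proof -
      have E: "E (prod_encode (m, n), a) r" if "orbit G F m n a r" for m n r
        using that unfolding E_def by simp
      have "dense_below q (Z a)" using that unfolding z_def Mem_to_name[of Z, OF Z] .
      then show ?thesis by (rule dense_below_weaken) (unfold Z_def, blast intro: E)
    qed
  qed
  moreover have "(z \<^bold>\<subseteq> check X) p"
  proof (rule SubI)
    fix a q assume q: "q \<in> P" "(a \<^bold>\<in> z) q"
    then have "a \<in> X" unfolding z_def Mem_to_name[of Z, OF Z] using dense_belowD ZX by blast
    then show "(a \<^bold>\<in> check X) q" using q(1) by (simp add: Mem_check)
  qed
  ultimately have "CtblSubset X z p" using CtblSubsetI[OF p] by blast
  moreover have "Closed_for R c z p"
    unfolding Closed_for_iff
  proof (intro allI ballI impI)
    fix b q assume q: "q \<in> P" "q \<preceq> p" "(b \<^bold>\<in> z) q"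
    have "dense_below q (Z b)" using q(3) unfolding z_def Mem_to_name[of Z, OF Z] .
    then show "dense_below q (\<lambda>r. \<exists>a. R b a \<and> (a \<^bold>\<in> c) r \<and> (a \<^bold>\<in> z) r)"
    proof (rule dense_below_trans)
      fix r assume r: "r \<in> P" "r \<preceq> q" "Z b r"
      have "dense_below r (\<lambda>r. \<exists>a. G b a r)"
        using Gdense ZX[OF r(3)] r(2) q(2) le_trans by blast
      then show "dense_below r (\<lambda>r. \<exists>a. R b a \<and> (a \<^bold>\<in> c) r \<and> (a \<^bold>\<in> z) r)"
      proof (rule dense_below_weaken)
        fix t assume t: "t \<in> P" "t \<preceq> r" "\<exists>a. G b a t"
        then obtain a where a: "G b a t" by blast
        have "Z b t" using downwardD[OF Z r(3)] r t by blast
        then have "Z a t" unfolding Z_def using a orbit_Suc[of G F] by blast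
        then have "(a \<^bold>\<in> z) t" unfolding z_def using Mem_to_nameI[of Z, OF Z] t(1) by blast
        then show "\<exists>a. R b a \<and> (a \<^bold>\<in> c) t \<and> (a \<^bold>\<in> z) t" using G(2)[OF a] unfolding N_def by blast
      qed
    qed
  qed
  moreover have "(y \<^bold>\<subseteq> z) p"
  proof (rule SubI)
    fix a q assume q: "q \<in> P" "q \<preceq> p" "(a \<^bold>\<in> y) q"
    have "a \<in> X" using SubD[OF yX q(3) q(2,1)] q(1) by (simp add: Mem_check)
    moreover have "dense_below q (\<lambda>r. \<exists>n. ((n, a) \<^bold>\<in> f) r)"
      using f q unfolding Enumerates_iff by blast
    moreover have "Z a r" if "a \<in> X" "\<exists>n. ((n, a) \<^bold>\<in> f) r" for r
      using that orbit_0[of F] unfolding Z_def F_def by blast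
    ultimately have "dense_below q (Z a)" by (elim dense_below_weaken)
    then show "(a \<^bold>\<in> z) q" unfolding z_def Mem_to_name[of Z, OF Z] .
  qed
  ultimately show thesis by (rule that)
qed

definition closed_sets_name where
  "closed_sets_name X R c p =
     {(z, q). q \<in> P \<and> q \<preceq> p \<and> CtblSubset X z q \<and> Closed_for R c z q}"

text \<open>
  The family contains names only, but membership in it is up to equality of names, and both
  defining properties respect this equality.
\<close>

lemma MemFam_closed_sets_name:
  assumes "q \<in> P" "q \<preceq> p"
  shows "(y \<^bold>\<in>\<^bold>\<in> closed_sets_name X R c p) q \<longleftrightarrow> CtblSubset X y q \<and> Closed_for R c y q"
proof
  assume "CtblSubset X y q \<and> Closed_for R c y q"
  then have "(y, q) \<in> closed_sets_name X R c p" using assms unfolding closed_sets_name_def by blast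
  moreover have "(y \<^bold>\<subseteq> y) r" for r by (rule SubI)
  ultimately show "(y \<^bold>\<in>\<^bold>\<in> closed_sets_name X R c p) q"
    unfolding MemFam_def dense_below_def using assms le_refl by blast
next
  assume *: "(y \<^bold>\<in>\<^bold>\<in> closed_sets_name X R c p) q"
  have step: "CtblSubset X y r \<and> Closed_for R c y r"
    if r: "r \<in> P" and "\<exists>z. \<exists>t\<in>P. (z, t) \<in> closed_sets_name X R c p \<and> r \<preceq> t \<and> (y \<^bold>\<subseteq> z) r \<and> (z \<^bold>\<subseteq> y) r" for r
  proof -
    from that obtain z t where z: "t \<in> P" "CtblSubset X z t" "Closed_for R c z t" "r \<preceq> t" 
        "(y \<^bold>\<subseteq> z) r" "(z \<^bold>\<subseteq> y) r"
      unfolding closed_sets_name_def by blast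
    have "CtblSubset X z r" "Closed_for R c z r"
      using regular_open_mono[OF regular_open_CtblSubset z(2,4)]
        regular_open_mono[OF regular_open_Closed_for z(3,4)] z(1) r by auto
    then show ?thesis using CtblSubset_subset Closed_for_eq z(5,6) r by blast
  qed
  have "dense_below q (CtblSubset X y \<^bold>\<and> Closed_for R c y)"
    unfolding Conj_def by (rule dense_below_weaken[OF *[unfolded MemFam_def] step])
  then have "(CtblSubset X y \<^bold>\<and> Closed_for R c y) q"
    by (rule regular_open_dense[OF regular_open_Conj[OF regular_open_CtblSubset regular_open_Closed_for] assms(1)])
  then show "CtblSubset X y q \<and> Closed_for R c y q" unfolding Conj_def .
qed

text \<open>
  The hypothesis says that \<open>p\<close> forces every \<open>b \<in> X\<close> to have some \<open>a \<in> c \<inter> X\<close> with \<open>R b a\<close>; it is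
  what allows closing off a countable set.
\<close>

lemma Club_closed_sets_name:
  assumes p: "p \<in> P"
    and unb: "\<And>b q. b \<in> X \<Longrightarrow> q \<in> P \<Longrightarrow> q \<preceq> p \<Longrightarrow> \<exists>r\<in>P. r \<preceq> q \<and> (\<exists>a\<in>X. R b a \<and> (a \<^bold>\<in> c) r)"
  shows "Club X (closed_sets_name X R c p) p"
  unfolding Club_def Conj_def All_def Imp_def
proof (intro conjI allI ballI impI)
  fix y q assume "q \<in> P" "q \<preceq> p" "(y \<^bold>\<in>\<^bold>\<in> closed_sets_name X R c p) q"
  then show "CtblSubset X y q" using MemFam_closed_sets_name by blast
next
  fix y q assume q: "q \<in> P" "q \<preceq> p" "CtblSubset X y q"
  show "(\<^bold>\<exists>z. (\<lambda>r. (z \<^bold>\<in>\<^bold>\<in> closed_sets_name X R c p) r \<and> (y \<^bold>\<subseteq> z) r)) q"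
    unfolding Ex_def dense_below_def
  proof (intro ballI impI)
    fix r assume r: "r \<in> P" "r \<preceq> q"
    have rp: "r \<preceq> p" using r q le_trans by blast
    have y: "CtblSubset X y r"
      by (rule regular_open_mono[OF regular_open_CtblSubset q(3) r(2) q(1) r(1)])
    have unb': "\<exists>t\<in>P. t \<preceq> u \<and> (\<exists>a\<in>X. R b a \<and> (a \<^bold>\<in> c) t)" if "b \<in> X" "u \<in> P" "u \<preceq> r" for b u
      by (rule unb[OF that(1,2) le_trans[OF that(3) rp]])
    obtain z where "CtblSubset X z r" "Closed_for R c z r" "(y \<^bold>\<subseteq> z) r"
      by (rule CtblSubset_closure[of r X y R c]) (use r(1) y unb' in blast)+
    then show "\<exists>t\<in>P. t \<preceq> r \<and> (\<exists>z. (z \<^bold>\<in>\<^bold>\<in> closed_sets_name X R c p) t \<and> (y \<^bold>\<subseteq> z) t)"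
      using MemFam_closed_sets_name[OF r(1) rp] r(1) le_refl by blast
  qed
next
  fix s q assume q: "q \<in> P" "q \<preceq> p"
    "\<forall>n. (nth_name s n \<^bold>\<in>\<^bold>\<in> closed_sets_name X R c p) q \<and> (nth_name s n \<^bold>\<subseteq> nth_name s (Suc n)) q"
  then show "(Union_name s \<^bold>\<in>\<^bold>\<in> closed_sets_name X R c p) q"
    using MemFam_closed_sets_name[OF q(1,2)] CtblSubset_Union_name[OF q(1)] Closed_for_Union_name
    by metis
qed

text \<open>
  The form in which preservation of stationarity is applied: a preserved stationary set meets the
  club of closed sets, in a ground model set \<open>x\<close>.
\<close>

lemma Stationary_imp_closed:
  assumes p: "p \<in> P" and S: "Stationary X S p"
    and unb: "\<And>b q. b \<in> X \<Longrightarrow> q \<in> P \<Longrightarrow> q \<preceq> p \<Longrightarrow> \<exists>r\<in>P. r \<preceq> q \<and> (\<exists>a\<in>X. R b a \<and> (a \<^bold>\<in> c) r)"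
  obtains x q where "x \<in> S" "q \<in> P" "q \<preceq> p"
    "\<And>b. b \<in> x \<Longrightarrow> dense_below q (\<lambda>r. \<exists>a\<in>x. R b a \<and> (a \<^bold>\<in> c) r)"
proof -
  have "Club X (closed_sets_name X R c p) p" using Club_closed_sets_name assms by blast
  then have "dense_below p (\<lambda>q. \<exists>x. x \<in> S \<and> (check x \<^bold>\<in>\<^bold>\<in> closed_sets_name X R c p) q)"
    using S p le_refl unfolding Stationary_def All_def Imp_def Ex_def Conj_def Ground_def by blast
  then obtain x q where x: "x \<in> S" "q \<in> P" "q \<preceq> p"
    and "(check x \<^bold>\<in>\<^bold>\<in> closed_sets_name X R c p) q"
    using dense_belowD[OF _ p] by blast
  then have *: "Closed_for R c (check x) q" using MemFam_closed_sets_name by blast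
  have "dense_below q (\<lambda>r. \<exists>a\<in>x. R b a \<and> (a \<^bold>\<in> c) r)" if "b \<in> x" for b
  proof -
    have "dense_below q (\<lambda>r. \<exists>a. R b a \<and> (a \<^bold>\<in> c) r \<and> (a \<^bold>\<in> check x) r)"
      using * that x(2) Mem_check[OF x(2), of b x] le_refl unfolding Closed_for_iff by blast
    then show ?thesis by (rule dense_below_weaken) (auto simp: Mem_check)
  qed
  then show thesis using that x by blast
qed

end

section \<open>Stationary subsets of a regular uncountable cardinal\<close>

locale regular_uncountable =
  fixes k :: "'a rel"
  assumes Card_order: "Card_order k"
    and uncountable: "natLeq <o k"
    and regular: "regularCard k"
begin

abbreviation less :: "'a \<Rightarrow> 'a \<Rightarrow> bool"  (infix "\<sqsubset>" 50) where "a \<sqsubset> b \<equiv> a \<in> underS k b"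
abbreviation leq :: "'a \<Rightarrow> 'a \<Rightarrow> bool"  (infix "\<sqsubseteq>" 50) where "a \<sqsubseteq> b \<equiv> (a, b) \<in> k"

lemma Well_order: "Well_order k"
  using Card_order card_order_on_well_order_on by blast

lemma in_Field: "a \<sqsubseteq> b \<Longrightarrow> a \<in> Field k \<and> b \<in> Field k"
  unfolding Field_def by blast

lemma less_in_Field: "a \<sqsubset> b \<Longrightarrow> a \<in> Field k \<and> b \<in> Field k"
  unfolding underS_def Field_def by blast

lemma less_imp_leq: "a \<sqsubset> b \<Longrightarrow> a \<sqsubseteq> b"
  unfolding underS_def by blast

lemma leq_refl: "a \<in> Field k \<Longrightarrow> a \<sqsubseteq> a"
  using Well_order unfolding order_on_defs refl_on_def by blast

lemma leq_trans: "a \<sqsubseteq> b \<Longrightarrow> b \<sqsubseteq> c \<Longrightarrow> a \<sqsubseteq> c"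
  using Well_order unfolding order_on_defs by (meson transD)

lemma leq_antisym: "a \<sqsubseteq> b \<Longrightarrow> b \<sqsubseteq> a \<Longrightarrow> a = b"
  using Well_order unfolding order_on_defs by (meson antisymD)

lemma less_irrefl: "\<not> a \<sqsubset> a"
  unfolding underS_def by blast

lemma less_leq_trans: "a \<sqsubset> b \<Longrightarrow> b \<sqsubseteq> c \<Longrightarrow> a \<sqsubset> c"
  unfolding underS_def using leq_trans leq_antisym by blast

lemma leq_less_trans: "a \<sqsubseteq> b \<Longrightarrow> b \<sqsubset> c \<Longrightarrow> a \<sqsubset> c"
  unfolding underS_def using leq_trans leq_antisym by blast

lemma less_trans: "a \<sqsubset> b \<Longrightarrow> b \<sqsubset> c \<Longrightarrow> a \<sqsubset> c"
  using leq_less_trans less_imp_leq by blast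

lemma not_less_iff: "a \<in> Field k \<Longrightarrow> b \<in> Field k \<Longrightarrow> \<not> a \<sqsubset> b \<longleftrightarrow> b \<sqsubseteq> a"
proof -
  assume a: "a \<in> Field k" "b \<in> Field k"
  have "a \<sqsubseteq> b \<or> b \<sqsubseteq> a"
  proof (cases "a = b")
    case True then show ?thesis using leq_refl a by blast
  next
    case False
    have "Total k" using Well_order unfolding order_on_defs by blast
    then show ?thesis using False a unfolding total_on_def by blast
  qed
  then show ?thesis using leq_antisym leq_refl[OF a(1)] unfolding underS_def by blast
qed

lemma ex_least:
  assumes "S \<subseteq> Field k" "S \<noteq> {}"
  shows "\<exists>m\<in>S. \<forall>a\<in>S. m \<sqsubseteq> a"
proof -
  have "wf (k - Id)" using Well_order unfolding well_order_on_def by blast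
  then obtain m where "m \<in> S" "\<And>a. (a, m) \<in> k - Id \<Longrightarrow> a \<notin> S"
    using assms(2) wf_eq_minimal[of "k - Id"] by blast
  moreover then have "\<not> a \<sqsubset> m" if "a \<in> S" for a
    using that unfolding underS_def by blast
  ultimately show ?thesis using assms(1) not_less_iff by blast
qed

lemma infinite_Field: "infinite (Field k)"
proof -
  have "natLeq \<le>o |Field k|"
    using uncountable card_of_Field_ordIso[OF Card_order] ordLess_imp_ordLeq ordLeq_ordIso_trans
      ordIso_symmetric by blast
  then show ?thesis using infinite_iff_natLeq_ordLeq by blast
qed

lemma card_nat_less: "|UNIV :: nat set| <o k"
  using card_of_nat uncountable ordIso_ordLess_trans by blast

lemma card_countable_less: "countable A \<Longrightarrow> |A| <o k"
proof -
  assume "countable A"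
  then have "|A| \<le>o |UNIV :: nat set|" unfolding countable_def by (rule exE) (rule card_of_ordLeqI, auto)
  then show ?thesis using card_nat_less ordLeq_ordLess_trans by blast
qed

lemma not_countable_Field: "\<not> countable (Field k)"
proof
  assume "countable (Field k)"
  then have "|Field k| <o k" by (rule card_countable_less)
  then show False
    using card_of_Field_ordIso[OF Card_order] not_ordLess_ordIso by blast
qed

lemma ex_greater: "a \<in> Field k \<Longrightarrow> \<exists>b\<in>Field k. a \<sqsubset> b"
  using infinite_Card_order_limit[OF Card_order infinite_Field] unfolding underS_def by blast

lemma bounded:
  assumes "|A| <o k" and "\<And>a. a \<in> A \<Longrightarrow> h a \<in> Field k"
  shows "\<exists>b\<in>Field k. \<forall>a\<in>A. h a \<sqsubset> b"
proof -
  have "|h ` A| <o k" using card_of_image assms(1) ordLeq_ordLess_trans by blast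
  then have "\<not> |h ` A| =o k" using not_ordLess_ordIso by blast
  then have "\<not> cofinal (h ` A) k" using regular assms(2) unfolding regularCard_def by blast
  then obtain c where c: "c \<in> Field k" "\<forall>a\<in>A. \<not> c \<sqsubset> h a"
    unfolding cofinal_def underS_def by blast
  then obtain b where b: "b \<in> Field k" "c \<sqsubset> b" using ex_greater by blast
  have "h a \<sqsubset> b" if "a \<in> A" for a
    using that c b(2) not_less_iff assms(2) leq_less_trans by blast
  then show ?thesis using b(1) by blast
qed

lemma card_underS_less: "a \<in> Field k \<Longrightarrow> |underS k a| <o k"
  by (rule card_of_underS[OF Card_order])

lemma card_under_less: "a \<in> Field k \<Longrightarrow> |under k a| <o k"
proof -
  assume "a \<in> Field k"
  then obtain b where "b \<in> Field k" "a \<sqsubset> b" using ex_greater by blast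
  then have "under k a \<subseteq> underS k b" unfolding under_def using leq_less_trans by blast
  then show ?thesis by (rule ordLeq_ordLess_trans[OF card_of_mono1 card_underS_less[OF \<open>b \<in> Field k\<close>]])
qed

text \<open>
  Stationarity of sets of ordinals is expressed by closure points of functions rather than by
  clubs: the nonzero closure points of a function form a club, and every club contains those of
  the function that sends \<open>a\<close> to an element of the club above \<open>a\<close>.  With functions, diagonal
  intersections become pointwise bounds.
\<close>

definition closed_under :: "('a \<Rightarrow> 'a) \<Rightarrow> 'a \<Rightarrow> bool" where
  "closed_under g b \<longleftrightarrow> underS k b \<noteq> {} \<and> (\<forall>a. a \<sqsubset> b \<longrightarrow> g a \<sqsubset> b)"

definition stat :: "'a set \<Rightarrow> bool" where
  "stat T \<longleftrightarrow> T \<subseteq> Field k \<and> (\<forall>g. (\<forall>a\<in>Field k. g a \<in> Field k) \<longrightarrow> (\<exists>b\<in>T. closed_under g b))"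

lemma statD: "stat T \<Longrightarrow> (\<And>a. a \<in> Field k \<Longrightarrow> g a \<in> Field k) \<Longrightarrow> \<exists>b\<in>T. closed_under g b"
  unfolding stat_def by blast

lemma stat_mono: "stat S \<Longrightarrow> S \<subseteq> T \<Longrightarrow> T \<subseteq> Field k \<Longrightarrow> stat T"
  unfolding stat_def by blast

lemma closed_under_mono:
  assumes "closed_under h b" "\<And>a. a \<in> Field k \<Longrightarrow> g a \<sqsubseteq> h a" shows "closed_under g b"
  using assms less_in_Field leq_less_trans unfolding closed_under_def by blast

text \<open>
  If every fibre of \<open>f\<close> is avoided by the closure points of a function \<open>g c\<close>, then one function
  dominates all of them diagonally, and a closure point \<open>b\<close> of it is closed under \<open>g (f b)\<close>.
\<close>

lemma fodor:
  assumes T: "stat T" and f: "\<And>b. b \<in> T \<Longrightarrow> f b \<sqsubset> b"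
  shows "\<exists>c\<in>Field k. stat {b \<in> T. f b = c}"
proof (rule ccontr)
  assume no: "\<not> ?thesis"
  have "\<exists>g. (\<forall>a\<in>Field k. g a \<in> Field k) \<and> (\<forall>b\<in>T. f b = c \<longrightarrow> \<not> closed_under g b)" if "c \<in> Field k" for c
    using that no T unfolding stat_def by blast
  then obtain g where g: "\<And>c a. c \<in> Field k \<Longrightarrow> a \<in> Field k \<Longrightarrow> g c a \<in> Field k"
    "\<And>c b. c \<in> Field k \<Longrightarrow> b \<in> T \<Longrightarrow> f b = c \<Longrightarrow> \<not> closed_under (g c) b"
    by metis
  have "\<exists>h\<in>Field k. \<forall>c\<in>under k a. \<forall>a'\<in>under k a. g c a' \<sqsubset> h" if a: "a \<in> Field k" for a
  proof -
    have sub: "under k a \<subseteq> Field k" unfolding under_def using in_Field by blast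
    have "\<exists>m\<in>Field k. \<forall>a'\<in>under k a. g c a' \<sqsubset> m" if "c \<in> under k a" for c
      using bounded[OF card_under_less[OF a], of "g c"] g(1) that sub by blast
    then obtain m where m: "\<And>c. c \<in> under k a \<Longrightarrow> m c \<in> Field k"
      "\<And>c a'. c \<in> under k a \<Longrightarrow> a' \<in> under k a \<Longrightarrow> g c a' \<sqsubset> m c" by metis
    obtain h where "h \<in> Field k" "\<forall>c\<in>under k a. m c \<sqsubset> h"
      using bounded[OF card_under_less[OF a], of m] m(1) by blast
    then show ?thesis using m(2) less_trans by blast
  qed
  then have "\<forall>a\<in>Field k. \<exists>h. h \<in> Field k \<and> (\<forall>c a'. c \<sqsubseteq> a \<longrightarrow> a' \<sqsubseteq> a \<longrightarrow> g c a' \<sqsubset> h)"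
    unfolding under_def by blast
  from bchoice[OF this] obtain h where h: "\<And>a. a \<in> Field k \<Longrightarrow> h a \<in> Field k"
    "\<And>a c a'. a \<in> Field k \<Longrightarrow> c \<sqsubseteq> a \<Longrightarrow> a' \<sqsubseteq> a \<Longrightarrow> g c a' \<sqsubset> h a"
    by blast
  obtain b where b: "b \<in> T" "closed_under h b" using statD[OF T, of h] h(1) by blast
  \<comment> \<open>the fibre that contains \<open>b\<close>; \<open>m\<close> below is the larger of \<open>?c\<close> and \<open>a\<close>\<close>
  let ?c = "f b"
  have c: "?c \<sqsubset> b" "?c \<in> Field k" using f[OF b(1)] less_in_Field by auto
  have "g ?c a \<sqsubset> b" if a: "a \<sqsubset> b" for a
  proof -
    have "\<exists>m. m \<sqsubset> b \<and> ?c \<sqsubseteq> m \<and> a \<sqsubseteq> m"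
    proof (cases "a \<sqsubset> ?c")
      case True
      then show ?thesis using c less_imp_leq leq_refl by blast
    next
      case False
      then have "?c \<sqsubseteq> a" using not_less_iff less_in_Field[OF a] c(2) by blast
      then show ?thesis using a leq_refl less_in_Field[OF a] by blast
    qed
    then obtain m where m: "m \<sqsubset> b" "?c \<sqsubseteq> m" "a \<sqsubseteq> m" by blast
    then have "g ?c a \<sqsubset> h m" using h(2) less_in_Field by blast
    then show ?thesis using b(2) m(1) less_trans unfolding closed_under_def by blast
  qed
  then have "closed_under (g ?c) b" using c(1) unfolding closed_under_def by blast
  then show False using g(2)[OF c(2) b(1)] by blast
qed

definition cofinal_seq :: "(nat \<Rightarrow> 'a) \<Rightarrow> 'a \<Rightarrow> bool" where
  "cofinal_seq u b \<longleftrightarrow> (\<forall>n. u n \<sqsubset> b) \<and> (\<forall>a. a \<sqsubset> b \<longrightarrow> (\<exists>n. a \<sqsubseteq> u n))"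

definition cof_omega :: "'a set" where
  "cof_omega = {b. \<exists>u. cofinal_seq u b}"

lemma cof_omega_Field: "cof_omega \<subseteq> Field k"
  unfolding cof_omega_def cofinal_seq_def using less_in_Field by blast

text \<open>
  The supremum of an \<open>\<omega>\<close>-sequence that at each step exceeds all values of \<open>g\<close> so far is a closure
  point of \<open>g\<close>.
\<close>

lemma stat_cof_omega: "stat cof_omega"
  unfolding stat_def
proof (intro conjI allI impI)
  fix g assume g: "\<forall>a\<in>Field k. g a \<in> Field k"
  have "\<exists>m\<in>Field k. a \<sqsubset> m \<and> (\<forall>a'. a' \<sqsubset> a \<longrightarrow> g a' \<sqsubset> m)" if a: "a \<in> Field k" for a
  proof -
    obtain m where m: "m \<in> Field k" "\<forall>a'\<in>underS k a. g a' \<sqsubset> m"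
      using bounded[OF card_underS_less[OF a], of g] g less_in_Field by blast
    show ?thesis
    proof (cases "a \<sqsubset> m")
      case True then show ?thesis using m by blast
    next
      case False
      then have "m \<sqsubseteq> a" using not_less_iff a m(1) by blast
      moreover obtain m' where "m' \<in> Field k" "a \<sqsubset> m'" using ex_greater a by blast
      ultimately show ?thesis using m less_trans leq_less_trans by blast
    qed
  qed
  then obtain s where s: "\<And>a. a \<in> Field k \<Longrightarrow> s a \<in> Field k" "\<And>a. a \<in> Field k \<Longrightarrow> a \<sqsubset> s a"
    "\<And>a a'. a \<in> Field k \<Longrightarrow> a' \<sqsubset> a \<Longrightarrow> g a' \<sqsubset> s a" by metis
  obtain a0 where a0: "a0 \<in> Field k" using infinite_Field by fastforce
  \<comment> \<open>the ordinal \<open>b\<close> below is the supremum of this sequence\<close>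
  define u where "u n = (s ^^ n) a0" for n
  have u: "u n \<in> Field k" for n unfolding u_def by (induction n) (use a0 s(1) in auto)
  have uS: "u (Suc n) = s (u n)" for n unfolding u_def by simp
  have "{b \<in> Field k. \<forall>n. u n \<sqsubset> b} \<noteq> {}" using bounded[OF card_nat_less, of u] u by blast
  then obtain b where b: "b \<in> Field k" "\<And>n. u n \<sqsubset> b"
    and least: "\<And>c. c \<in> Field k \<Longrightarrow> \<forall>n. u n \<sqsubset> c \<Longrightarrow> b \<sqsubseteq> c"
    using ex_least[of "{b \<in> Field k. \<forall>n. u n \<sqsubset> b}"] by blast
  have cof: "\<exists>n. a \<sqsubseteq> u n" if a: "a \<sqsubset> b" for a
  proof (rule ccontr)
    assume "\<not> ?thesis"
    then have "\<forall>n. u n \<sqsubset> a" using not_less_iff u less_in_Field[OF a] by blast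
    then have "b \<sqsubseteq> a" using least less_in_Field[OF a] by blast
    then show False using a leq_less_trans less_irrefl by blast
  qed
  have "g a \<sqsubset> b" if "a \<sqsubset> b" for a
  proof -
    obtain n where "a \<sqsubseteq> u n" using cof \<open>a \<sqsubset> b\<close> by blast
    then have "a \<sqsubset> u (Suc n)" using s(2)[OF u] leq_less_trans unfolding uS by blast
    then have "g a \<sqsubset> u (Suc (Suc n))" using s(3)[OF u] unfolding uS[of "Suc n"] by blast
    then show ?thesis using b(2) less_trans by blast
  qed
  then have "closed_under g b" using b(2) unfolding closed_under_def by blast
  moreover have "b \<in> cof_omega" using b(2) cof unfolding cof_omega_def cofinal_seq_def by blast
  ultimately show "\<exists>b\<in>cof_omega. closed_under g b" by blast
qed (rule cof_omega_Field)

text \<open>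
  Solovay's splitting in the easy case of cofinality \<open>\<omega>\<close>.  Attach to each \<open>b\<close> a cofinal sequence
  \<open>u b\<close>.  For some \<open>n\<close> the values \<open>u b n\<close> exceed any given bound stationarily often: otherwise,
  for each \<open>n\<close>, almost all values are below a bound, the supremum of these countably many bounds
  is below \<open>\<kappa>\<close>, and almost all sequences stay below it, although they are cofinal in larger
  ordinals.  By Fodor's lemma \<open>b \<mapsto> u b n\<close> then has unboundedly many, hence \<open>\<kappa>\<close> many, stationary
  fibres.
\<close>

lemma ex_disjoint_stat:
  obtains f :: "'a \<Rightarrow> 'a" and Z where "Z \<subseteq> Field k" "|Z| =o k"
    "\<And>c. c \<in> Z \<Longrightarrow> stat {b \<in> cof_omega. f b = c}"
proof -
  have "\<forall>b\<in>cof_omega. \<exists>u. cofinal_seq u b" unfolding cof_omega_def by blast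
  then obtain u where u: "\<And>b. b \<in> cof_omega \<Longrightarrow> cofinal_seq (u b) b" by metis
  have "\<exists>n. \<forall>a\<in>Field k. stat {b \<in> cof_omega. a \<sqsubseteq> u b n}"
  proof (rule ccontr)
    assume "\<not> ?thesis"
    then have "\<forall>n. \<exists>a\<in>Field k. \<exists>g. (\<forall>a\<in>Field k. g a \<in> Field k) \<and>
        (\<forall>b\<in>cof_omega. a \<sqsubseteq> u b n \<longrightarrow> \<not> closed_under g b)"
      using cof_omega_Field unfolding stat_def by blast
    then obtain a g where a: "\<And>n. a n \<in> Field k" and g: "\<And>n c. c \<in> Field k \<Longrightarrow> g n c \<in> Field k"
      and not_closed: "\<And>n b. b \<in> cof_omega \<Longrightarrow> a n \<sqsubseteq> u b n \<Longrightarrow> \<not> closed_under (g n) b"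
      by metis
    obtain a' where a': "a' \<in> Field k" "\<And>n. a n \<sqsubset> a'" using bounded[OF card_nat_less, of a] a by blast
    have "\<exists>m\<in>Field k. a' \<sqsubset> m \<and> (\<forall>n. g n c \<sqsubset> m)" if c: "c \<in> Field k" for c
    proof -
      define v where "v = case_nat a' (\<lambda>n. g n c)"
      have "v n \<in> Field k" for n unfolding v_def using a'(1) g[OF c] by (cases n) auto
      then obtain m where m: "m \<in> Field k" "\<And>n. v n \<sqsubset> m" using bounded[OF card_nat_less, of v] by blast
      have "a' \<sqsubset> m" using m(2)[of 0] unfolding v_def by simp
      moreover have "g n c \<sqsubset> m" for n using m(2)[of "Suc n"] unfolding v_def by simp
      ultimately show ?thesis using m(1) by blast
    qed
    then obtain h where h: "\<And>c. c \<in> Field k \<Longrightarrow> h c \<in> Field k"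
      "\<And>c. c \<in> Field k \<Longrightarrow> a' \<sqsubset> h c" "\<And>c n. c \<in> Field k \<Longrightarrow> g n c \<sqsubset> h c" by metis
    obtain b where b: "b \<in> cof_omega" "closed_under h b"
      using statD[OF stat_cof_omega, of h] h(1) by blast
    then obtain c where "c \<sqsubset> b" "h c \<sqsubset> b" unfolding closed_under_def by blast
    then have "a' \<sqsubset> b" using h(2) less_in_Field less_trans by blast
    then obtain n where "a' \<sqsubseteq> u b n" using u[OF b(1)] unfolding cofinal_seq_def by blast
    then have "a n \<sqsubseteq> u b n" using a'(2) less_imp_leq leq_trans by blast
    moreover have "closed_under (g n) b"
      by (rule closed_under_mono[OF b(2)]) (use h(3) less_imp_leq in blast)
    ultimately show False using not_closed[OF b(1)] by blast
  qed
  then obtain n where n: "\<And>a. a \<in> Field k \<Longrightarrow> stat {b \<in> cof_omega. a \<sqsubseteq> u b n}" by blast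
  define f where "f b = u b n" for b
  define Z where "Z = {c \<in> Field k. stat {b \<in> cof_omega. f b = c}}"
  have unbounded: "\<exists>c\<in>Z. a \<sqsubseteq> c" if "a \<in> Field k" for a
  proof -
    have "f b \<sqsubset> b" if "b \<in> {b \<in> cof_omega. a \<sqsubseteq> f b}" for b
      using that u unfolding f_def cofinal_seq_def by blast
    then obtain c where c: "c \<in> Field k" "stat {b \<in> {b \<in> cof_omega. a \<sqsubseteq> f b}. f b = c}"
      using fodor n[OF \<open>a \<in> Field k\<close>, folded f_def] by blast
    obtain b where b: "b \<in> {b \<in> {b \<in> cof_omega. a \<sqsubseteq> f b}. f b = c}"
      using statD[OF c(2), of "\<lambda>a. a"] by blast
    have "stat {b \<in> cof_omega. f b = c}"
      by (rule stat_mono[OF c(2)]) (use cof_omega_Field in blast)+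
    then show ?thesis using b c(1) unfolding Z_def by blast
  qed
  have "cofinal Z k"
    unfolding cofinal_def
  proof
    fix a assume "a \<in> Field k"
    then obtain b where "b \<in> Field k" "a \<sqsubset> b" using ex_greater by blast
    then obtain c where "c \<in> Z" "a \<sqsubset> c" using unbounded less_leq_trans by blast
    then show "\<exists>c\<in>Z. a \<noteq> c \<and> a \<sqsubseteq> c" unfolding underS_def by blast
  qed
  moreover have "Z \<subseteq> Field k" unfolding Z_def by blast
  ultimately have "|Z| =o k" using regular[unfolded regularCard_def, THEN spec, of Z] by blast
  then show thesis using that[of Z f] unfolding Z_def by blast
qed

text \<open>
  Induction on the length of the lists avoids computing the cardinality of the set of lists.
\<close>

lemma bounded_lists:
  assumes F: "\<And>l. l \<in> lists (Field k) \<Longrightarrow> F l \<in> Field k" and a: "a \<in> Field k"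
  shows "\<exists>b\<in>Field k. \<forall>l\<in>lists (under k a). F l \<sqsubset> b"
proof -
  have sub: "under k a \<subseteq> Field k" unfolding under_def using in_Field by blast
  have "\<exists>b\<in>Field k. \<forall>l\<in>lists (under k a). length l = n \<longrightarrow> F l \<sqsubset> b" for n
    using F
  proof (induction n arbitrary: F)
    case 0
    then show ?case using ex_greater[of "F []"] by auto
  next
    case (Suc n)
    have "\<exists>b\<in>Field k. \<forall>l\<in>lists (under k a). length l = n \<longrightarrow> F (c # l) \<sqsubset> b" if "c \<in> under k a" for c
    proof (rule Suc.IH)
      show "F (c # l) \<in> Field k" if "l \<in> lists (Field k)" for l
        using Suc.prems[of "c # l"] that subsetD[OF sub \<open>c \<in> under k a\<close>] by simp
    qed
    then obtain m where m: "\<And>c. c \<in> under k a \<Longrightarrow> m c \<in> Field k"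
      "\<And>c l. c \<in> under k a \<Longrightarrow> l \<in> lists (under k a) \<Longrightarrow> length l = n \<Longrightarrow> F (c # l) \<sqsubset> m c"
      by metis
    obtain b where b: "b \<in> Field k" "\<forall>c\<in>under k a. m c \<sqsubset> b"
      using bounded[OF card_under_less[OF a], of m] m(1) by blast
    have "F l \<sqsubset> b" if l0: "l \<in> lists (under k a)" "length l = Suc n" for l
    proof -
      obtain c l' where l: "l = c # l'" "length l' = n" using l0(2) by (cases l) auto
      then have "c \<in> under k a" "l' \<in> lists (under k a)" using l0(1) by auto
      then show ?thesis using m(2)[of c l'] b(2) l less_trans by blast
    qed
    then show ?case using b(1) by blast
  qed
  then obtain m where m: "\<And>n. m n \<in> Field k"
    "\<And>n l. l \<in> lists (under k a) \<Longrightarrow> length l = n \<Longrightarrow> F l \<sqsubset> m n" by metis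
  obtain b where "b \<in> Field k" "\<forall>n. m n \<sqsubset> b" using bounded[OF card_nat_less, of m] m(1) by blast
  then show ?thesis using m(2) less_trans by blast
qed

text \<open>
  The countable sets whose supremum lies in \<open>T\<close> and is not attained.
\<close>

definition sups_in :: "'a set \<Rightarrow> 'a set set" where
  "sups_in T = {x \<in> ctbl_subsets (Field k).
     \<exists>b\<in>T. x \<subseteq> underS k b \<and> (\<forall>a. a \<sqsubset> b \<longrightarrow> (\<exists>c\<in>x. a \<sqsubseteq> c))}"

text \<open>
  Choose members \<open>z l\<close> of the club \<open>C\<close>, indexed by finite lists, with \<open>z (a # l)\<close> containing \<open>a\<close>
  and \<open>z l\<close>.  If \<open>b \<in> T\<close> is closed under bounds for the sets \<open>z l\<close>, then the \<open>z l\<close> for the finite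
  initial parts \<open>l\<close> of a sequence cofinal in \<open>b\<close> form a chain, whose union is in \<open>C\<close> and has
  supremum \<open>b\<close>.
\<close>

lemma stationary_sups_in:
  assumes T: "stat T" "T \<subseteq> cof_omega"
  shows "stationary (Field k) (sups_in T)"
  unfolding stationary_def
proof (intro conjI allI impI)
  show "sups_in T \<subseteq> ctbl_subsets (Field k)" unfolding sups_in_def by blast
  fix C assume C: "club (Field k) C"
  have C_sub: "x \<subseteq> Field k \<and> countable x" if "x \<in> C" for x
    using club_subset[OF C that] .
  have C_above: "\<exists>z\<in>C. y \<subseteq> z" if "y \<subseteq> Field k" "countable y" for y
    using club_above[OF C that] .
  \<comment> \<open>each \<open>z l\<close> is a member of \<open>C\<close> that contains all entries of \<open>l\<close>, increasing with \<open>l\<close>\<close>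
  define z where "z = rec_list (SOME c. c \<in> C) (\<lambda>a l zl. SOME c. c \<in> C \<and> insert a zl \<subseteq> c)"
  have step: "z (a # l) \<in> C \<and> insert a (z l) \<subseteq> z (a # l)" if "a \<in> Field k" "z l \<in> C" for a l
  proof -
    have "\<exists>c. c \<in> C \<and> insert a (z l) \<subseteq> c" using C_above[of "insert a (z l)"] C_sub that by blast
    then have "(SOME c. c \<in> C \<and> insert a (z l) \<subseteq> c) \<in> C
        \<and> insert a (z l) \<subseteq> (SOME c. c \<in> C \<and> insert a (z l) \<subseteq> c)"
      by (rule someI_ex)
    then show ?thesis unfolding z_def by simp
  qed
  have "z [] \<in> C" unfolding z_def using C_above[of "{}"] by (auto intro: someI)
  then have z: "z l \<in> C" if "l \<in> lists (Field k)" for l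
    using that by (induction l) (use step in auto)
  have z_Cons: "insert a (z l) \<subseteq> z (a # l)" if "a \<in> Field k" "l \<in> lists (Field k)" for a l
    using step[of a l] z[of l] that by blast
  have "\<exists>b\<in>Field k. \<forall>a\<in>z l. a \<sqsubset> b" if "l \<in> lists (Field k)" for l
    using bounded[OF card_countable_less, of "z l" "\<lambda>a. a"] C_sub[OF z[OF that]] by blast
  then obtain F where F: "\<And>l. l \<in> lists (Field k) \<Longrightarrow> F l \<in> Field k"
    "\<And>l a. l \<in> lists (Field k) \<Longrightarrow> a \<in> z l \<Longrightarrow> a \<sqsubset> F l" by metis
  obtain g where g: "\<And>a. a \<in> Field k \<Longrightarrow> g a \<in> Field k"
    "\<And>a l. a \<in> Field k \<Longrightarrow> l \<in> lists (under k a) \<Longrightarrow> F l \<sqsubset> g a"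
    using bounded_lists[of F] F(1) by metis
  obtain b where b: "b \<in> T" "closed_under g b" using statD[OF T(1), of g] g(1) by blast
  then obtain u :: "nat \<Rightarrow> 'a" where u: "\<And>n. u n \<sqsubset> b" "\<And>a. a \<sqsubset> b \<Longrightarrow> \<exists>n. a \<sqsubseteq> u n"
    using T(2) unfolding cof_omega_def cofinal_seq_def by blast
  \<comment> \<open>\<open>l n\<close> lists the first \<open>n\<close> values of \<open>u\<close>, the last one in front\<close>
  define l where "l = rec_nat [] (\<lambda>n l. u n # l)"
  have l_Suc: "l (Suc n) = u n # l n" and l_0: "l 0 = []" for n unfolding l_def by simp_all
  have l: "l n \<in> lists (Field k)" for n
    by (induction n) (use u(1) less_in_Field in \<open>auto simp: l_0 l_Suc\<close>)
  have l_below: "\<exists>a. a \<sqsubset> b \<and> l n \<in> lists (under k a)" for n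
  proof (induction n)
    case 0
    then show ?case using u(1) by (auto simp: l_0)
  next
    case (Suc n)
    then obtain a where a: "a \<sqsubset> b" "l n \<in> lists (under k a)" by blast
    show ?case
    proof (cases "a \<sqsubset> u n")
      case True
      then have "under k a \<subseteq> under k (u n)" "u n \<in> under k (u n)"
        unfolding under_def using less_imp_leq leq_trans leq_refl less_in_Field by blast+
      then show ?thesis using a(2) u(1) unfolding l_Suc by auto
    next
      case False
      then have "u n \<in> under k a" unfolding under_def using not_less_iff less_in_Field u(1) a(1) by blast
      then show ?thesis using a unfolding l_Suc by auto
    qed
  qed
  define x where "x = (\<Union>n. z (l n))"
  have "z (l n) \<subseteq> z (l (Suc n))" for n
    using z_Cons[OF _ l] less_in_Field u(1) unfolding l_Suc by blast
  then have "x \<in> C" unfolding x_def by (intro club_Union[OF C] z l)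
  moreover have "x \<subseteq> underS k b"
  proof
    fix c assume "c \<in> x"
    then obtain n where n: "c \<in> z (l n)" unfolding x_def by blast
    obtain a where a: "a \<sqsubset> b" "l n \<in> lists (under k a)" using l_below by blast
    have "c \<sqsubset> F (l n)" using F(2)[OF l n] .
    moreover have "F (l n) \<sqsubset> g a" using g(2) a less_in_Field by blast
    moreover have "g a \<sqsubset> b" using b(2) a(1) unfolding closed_under_def by blast
    ultimately show "c \<sqsubset> b" using less_trans by blast
  qed
  moreover have "\<exists>c\<in>x. a \<sqsubseteq> c" if a: "a \<sqsubset> b" for a
  proof -
    obtain n where n: "a \<sqsubseteq> u n" using u(2)[OF a] by blast
    have "u n \<in> z (l (Suc n))" using z_Cons[OF _ l] less_in_Field u(1) unfolding l_Suc by blast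
    then show ?thesis using n unfolding x_def by blast
  qed
  ultimately have "x \<in> sups_in T"
    using C_sub[of x] b(1) unfolding sups_in_def ctbl_subsets_def by (intro CollectI conjI bexI[of _ b]) auto
  then show "sups_in T \<inter> C \<noteq> {}" using \<open>x \<in> C\<close> by blast
qed

text \<open>
  The limit points of \<open>B\<close> that are not above all of \<open>B\<close>.  Zero counts as one if \<open>B\<close> is nonempty;
  it has no cofinal \<open>\<omega>\<close>-sequence, so the stationary sets in question do not contain it.
\<close>

definition limit_points :: "'a set \<Rightarrow> 'a set" where
  "limit_points B =
     {b. (\<forall>a. a \<sqsubset> b \<longrightarrow> (\<exists>c\<in>B. a \<sqsubset> c \<and> c \<sqsubset> b)) \<and> (\<exists>c\<in>B. b \<sqsubseteq> c)}"

text \<open>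
  Mapping a limit point \<open>b\<close> to the least element of \<open>B\<close> that is not below \<open>b\<close> is injective, as
  there are elements of \<open>B\<close> between any two limit points.
\<close>

lemma card_limit_points:
  assumes "B \<subseteq> Field k"
  shows "|limit_points B| \<le>o |B|"
proof -
  have "\<forall>b\<in>limit_points B. \<exists>m. m \<in> B \<and> b \<sqsubseteq> m \<and> (\<forall>c\<in>B. b \<sqsubseteq> c \<longrightarrow> m \<sqsubseteq> c)"
  proof
    fix b assume "b \<in> limit_points B"
    then have "{c \<in> B. b \<sqsubseteq> c} \<noteq> {}" unfolding limit_points_def by blast
    from ex_least[OF _ this] show "\<exists>m. m \<in> B \<and> b \<sqsubseteq> m \<and> (\<forall>c\<in>B. b \<sqsubseteq> c \<longrightarrow> m \<sqsubseteq> c)"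
      using assms by blast
  qed
  from bchoice[OF this] obtain m where m: "\<And>b. b \<in> limit_points B \<Longrightarrow> m b \<in> B"
    "\<And>b. b \<in> limit_points B \<Longrightarrow> b \<sqsubseteq> m b"
    "\<And>b c. b \<in> limit_points B \<Longrightarrow> c \<in> B \<Longrightarrow> b \<sqsubseteq> c \<Longrightarrow> m b \<sqsubseteq> c" by blast
  have less: "m b \<sqsubset> m b'" if b: "b \<in> limit_points B" "b' \<in> limit_points B" "b \<sqsubset> b'" for b b'
  proof -
    obtain c where "c \<in> B" "b \<sqsubset> c" "c \<sqsubset> b'" using b(2,3) unfolding limit_points_def by blast
    then show ?thesis
      using m(3)[OF b(1)] m(2)[OF b(2)] less_imp_leq leq_less_trans less_leq_trans by blast
  qed
  have L: "limit_points B \<subseteq> Field k" unfolding limit_points_def using in_Field by blast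
  have "inj_on m (limit_points B)"
  proof (rule inj_onI)
    fix b b' assume b: "b \<in> limit_points B" "b' \<in> limit_points B" "m b = m b'"
    then have "\<not> b \<sqsubset> b'" "\<not> b' \<sqsubset> b" using less[of b b'] less[of b' b] less_irrefl by metis+
    then show "b = b'" using not_less_iff L b(1,2) leq_antisym by blast
  qed
  then show ?thesis using m(1) by (rule card_of_ordLeqI)
qed

end

section \<open>Ideals\<close>

context regular_uncountable begin

lemma positive_Diff:
  assumes "ideal_over A I" "X \<in> positive_sets A I" "N \<in> I"
  shows "X - N \<in> positive_sets A I"
proof -
  have "X - N \<notin> I"
  proof
    assume "X - N \<in> I"
    then have "(X - N) \<union> N \<in> I" using assms(1,3) unfolding ideal_over_def by blast
    moreover have "X \<subseteq> (X - N) \<union> N" by blast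
    ultimately have "X \<in> I" using assms(1) unfolding ideal_over_def by blast
    then show False using assms(2) unfolding positive_sets_def by blast
  qed
  then show ?thesis using assms(2) unfolding positive_sets_def by blast
qed

lemma positive_partition:
  assumes I: "complete_ideal k A I" and X: "X \<in> positive_sets A I"
    and f: "\<And>s. s \<in> X \<Longrightarrow> f s \<in> J" and J: "|J| <o k"
  shows "\<exists>j\<in>J. {s \<in> X. f s = j} \<in> positive_sets A I"
proof (rule ccontr)
  assume no: "\<not> ?thesis"
  let ?F = "(\<lambda>j. {s \<in> X. f s = j}) ` J"
  have "?F \<subseteq> I" using no X unfolding positive_sets_def by blast
  moreover have "|?F| <o k" by (rule ordLeq_ordLess_trans[OF card_of_image J])
  ultimately have "\<Union>?F \<in> I" using I unfolding complete_ideal_def by blast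
  moreover have "\<Union>?F = X" using f by blast
  ultimately have "X \<in> I" by simp
  then show False using X unfolding positive_sets_def by blast
qed

text \<open>
  Both parts of the theorem are instances.  The function \<open>tr\<close> sends a point of the underlying set
  to a subset of \<open>\<kappa>\<close>; fineness and normality are asked relative to \<open>tr\<close>.  The injection \<open>e\<close>
  carries \<open>\<kappa>\<close> into the sets of conditions, where properness applies.
\<close>

lemma not_proper_ideal:
  fixes I :: "'b set set" and tr :: "'b \<Rightarrow> 'a set" and d :: "'a rel" and e :: "'a \<Rightarrow> 'b set set"
  assumes I: "complete_ideal k A I"
    and tr: "\<And>s. s \<in> A \<Longrightarrow> tr s \<subseteq> Field k"
    and fine: "\<And>a. a \<in> Field k \<Longrightarrow> {s \<in> A. a \<notin> tr s} \<in> I"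
    and normal: "\<And>X f. X \<in> positive_sets A I \<Longrightarrow> (\<And>s. s \<in> X \<Longrightarrow> f s \<in> tr s) \<Longrightarrow>
      \<exists>Y\<in>positive_sets A I. Y \<subseteq> X \<and> (\<exists>c. \<forall>s\<in>Y. f s = c)"
    and d: "Card_order d" "cardSuc d <o k"
    and pos: "{s \<in> A. has_cofinality k (tr s) d} \<notin> I"
    and e: "inj e"
  shows "\<not> proper_ideal A I"
proof
  assume proper: "proper_ideal A I"
  let ?P = "positive_sets A I"
  interpret P: preorder_forcing ?P "(\<subseteq>)" by unfold_locales auto
  have ideal: "ideal_over A I" using I unfolding complete_ideal_def by blast
  define X0 where "X0 = {s \<in> A. has_cofinality k (tr s) d}"
  have X0: "X0 \<in> ?P" using pos unfolding X0_def positive_sets_def by blast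
  have "\<forall>s\<in>X0. \<exists>C. cofinal_in k (tr s) C \<and> |C| =o d" unfolding X0_def has_cofinality_def by blast
  from bchoice[OF this] obtain B where B: "\<And>s. s \<in> X0 \<Longrightarrow> cofinal_in k (tr s) (B s)"
    "\<And>s. s \<in> X0 \<Longrightarrow> |B s| =o d" by blast
  have B_tr: "B s \<subseteq> tr s" if "s \<in> X0" for s using B(1)[OF that] unfolding cofinal_in_def by blast
  have B_Field: "B s \<subseteq> Field k" if "s \<in> X0" for s
    using B_tr[OF that] tr[of s] that unfolding X0_def by blast
  have B_cofinal: "\<exists>c\<in>B s. a \<sqsubseteq> c" if "s \<in> X0" "a \<in> tr s" for s a
    using B(1)[OF that(1)] that(2) unfolding cofinal_in_def by blast
  define L where "L s = limit_points (B s)" for s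
  obtain f Z where Z: "Z \<subseteq> Field k" "|Z| =o k"
    "\<And>c. c \<in> Z \<Longrightarrow> stat {b \<in> cof_omega. f b = c}" by (rule ex_disjoint_stat) blast
  define S where "S c = {b \<in> cof_omega. f b = c}" for c
  have dS: "Card_order (cardSuc d)" by (rule cardSuc_Card_order[OF d(1)])
  have "|Field (cardSuc d)| \<le>o |Z|"
    using ordIso_ordLess_trans[OF card_of_Field_ordIso[OF dS] d(2)] Z(2)
      ordLess_ordIso_trans ordIso_symmetric ordLess_imp_ordLeq by blast
  then obtain h where h: "inj_on h (Field (cardSuc d))" "h ` Field (cardSuc d) \<subseteq> Z"
    using card_of_ordLeq[of "Field (cardSuc d)" Z] by blast
  define J where "J = h ` Field (cardSuc d)"
  have "|Field (cardSuc d)| =o |J|"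
    using h(1) card_of_ordIsoI[of h "Field (cardSuc d)" J] unfolding J_def bij_betw_def by blast
  then have J_card: "|J| =o cardSuc d"
    using card_of_Field_ordIso[OF dS] ordIso_transitive ordIso_symmetric by blast
  have J_less: "|J| <o k" by (rule ordIso_ordLess_trans[OF J_card d(2)])
  \<comment> \<open>Otherwise the limit points of \<open>B s\<close> would meet \<open>\<delta>\<^sup>+\<close> disjoint sets.\<close>
  have avoid: "\<exists>j\<in>J. S j \<inter> L s = {}" if s: "s \<in> X0" for s
  proof (rule ccontr)
    assume "\<not> ?thesis"
    then have "\<forall>j\<in>J. \<exists>b. b \<in> S j \<inter> L s" by blast
    from bchoice[OF this] obtain v where v: "\<And>j. j \<in> J \<Longrightarrow> v j \<in> S j \<inter> L s" by blast
    have "inj_on v J"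
    proof (rule inj_onI)
      fix i j assume "i \<in> J" "j \<in> J" "v i = v j"
      then show "i = j" using v[of i] v[of j] unfolding S_def by simp
    qed
    then have "|J| \<le>o |L s|" using v by (intro card_of_ordLeqI) blast+
    also have "|L s| \<le>o |B s|" unfolding L_def by (rule card_limit_points[OF B_Field[OF s]])
    also have "|B s| =o d" by (rule B(2)[OF s])
    also have "d <o cardSuc d" by (rule cardSuc_greater[OF d(1)])
    finally have "|J| <o cardSuc d" .
    then show False using J_card not_ordLess_ordIso by blast
  qed
  then have "\<forall>s\<in>X0. \<exists>j. j \<in> J \<and> S j \<inter> L s = {}" by blast
  from bchoice[OF this] obtain i where i: "\<And>s. s \<in> X0 \<Longrightarrow> i s \<in> J" "\<And>s. s \<in> X0 \<Longrightarrow> S (i s) \<inter> L s = {}"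
    by blast
  obtain j where j: "j \<in> J" "{s \<in> X0. i s = j} \<in> ?P"
    using positive_partition[OF I X0, of i J] i(1) J_less by blast
  define Y0 where "Y0 = {s \<in> X0. i s = j}"
  have Y0: "Y0 \<in> ?P" "Y0 \<subseteq> X0" "\<And>s. s \<in> Y0 \<Longrightarrow> S j \<inter> L s = {}"
    using j(2) i(2) unfolding Y0_def by auto
  have Sj: "stat (S j)" "S j \<subseteq> cof_omega"
    using Z(3)[of j] j(1) h(2) unfolding J_def S_def by auto
  have inj: "inj_on e (Field k)" using e inj_on_subset by blast
  have e_eq: "e a = e b \<longleftrightarrow> a = b" for a b using e by (simp add: inj_eq)

  have "stationary (e ` Field k) ((`) e ` sups_in (S j))"
    by (rule stationary_image[OF inj stationary_sups_in[OF Sj]])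
  moreover have "uncountable (e ` Field k)"
    using not_countable_Field countable_image_inj_on[OF _ inj] by blast
  ultimately have stationary: "P.Stationary (e ` Field k) ((`) e ` sups_in (S j)) Y0"
    using proper Y0(1) unfolding proper_ideal_def proper_forcing_def by blast

  \<comment> \<open>\<open>D\<close> is the generic subset of \<open>\<kappa>\<close> and \<open>R\<close> the order of \<open>\<kappa>\<close>, both transported by \<open>e\<close>\<close>
  define D where "D x Y \<longleftrightarrow> (\<exists>c. x = e c \<and> (\<forall>s\<in>Y. c \<in> B s))" for x Y
  define R where "R x y \<longleftrightarrow> (\<exists>a b. x = e a \<and> y = e b \<and> a \<sqsubset> b)" for x y
  have D: "P.downward (D x)" for x unfolding P.downward_def D_def by blast
  have D_e: "D (e c) Y \<longleftrightarrow> (\<forall>s\<in>Y. c \<in> B s)" for c Y unfolding D_def e_eq by blast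
  have R_e: "R (e a) (e b) \<longleftrightarrow> a \<sqsubset> b" for a b unfolding R_def e_eq by blast

  have unbounded: "\<exists>Y'\<in>?P. Y' \<subseteq> Y \<and> (\<exists>x\<in>e ` Field k. R y x \<and> P.Mem x (P.to_name D) Y')"
    if y: "y \<in> e ` Field k" and Y: "Y \<in> ?P" "Y \<subseteq> Y0" for y Y
  proof -
    obtain a where a: "a \<in> Field k" "y = e a" using y by blast
    \<comment> \<open>cofinality is meant non-strictly, so elements of \<open>B s\<close> above \<open>a\<close> are found above a larger \<open>a'\<close>\<close>
    obtain a' where a': "a' \<in> Field k" "a \<sqsubset> a'" using ex_greater a(1) by blast
    have Y1: "Y - {s \<in> A. a' \<notin> tr s} \<in> ?P" by (rule positive_Diff[OF ideal Y(1) fine[OF a'(1)]])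
    have "\<forall>s\<in>Y - {s \<in> A. a' \<notin> tr s}. \<exists>c. c \<in> B s \<and> a' \<sqsubseteq> c"
    proof
      fix s assume s: "s \<in> Y - {s \<in> A. a' \<notin> tr s}"
      then have "s \<in> X0" "a' \<in> tr s" using Y Y0(2) unfolding positive_sets_def by auto
      then show "\<exists>c. c \<in> B s \<and> a' \<sqsubseteq> c" using B_cofinal by blast
    qed
    from bchoice[OF this] obtain g where g: "\<And>s. s \<in> Y - {s \<in> A. a' \<notin> tr s} \<Longrightarrow> g s \<in> B s"
      "\<And>s. s \<in> Y - {s \<in> A. a' \<notin> tr s} \<Longrightarrow> a' \<sqsubseteq> g s" by blast
    have g_tr: "g s \<in> tr s" if "s \<in> Y - {s \<in> A. a' \<notin> tr s}" for s
      using g(1)[OF that] B_tr[of s] that Y(2) Y0(2) by blast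
    from normal[OF Y1 g_tr] obtain Y' c where Y': "Y' \<in> ?P" "Y' \<subseteq> Y - {s \<in> A. a' \<notin> tr s}"
      "\<And>s. s \<in> Y' \<Longrightarrow> g s = c" by blast
    have "Y' \<noteq> {}" using Y'(1) ideal unfolding positive_sets_def ideal_over_def by blast
    then have "a' \<sqsubseteq> c" using g(2) Y'(2,3) by blast
    then have c: "a \<sqsubset> c" using a'(2) less_leq_trans by blast
    have "c \<in> B s" if "s \<in> Y'" for s using g(1)[of s] Y'(2,3) that by blast
    then have "D (e c) Y'" unfolding D_e by blast
    then have "P.Mem (e c) (P.to_name D) Y'" by (rule P.Mem_to_nameI[of D, OF D Y'(1)])
    moreover have "R y (e c)" unfolding a(2) R_e by (rule c)
    moreover have "e c \<in> e ` Field k" using less_in_Field[OF c] by blast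
    ultimately show ?thesis using Y'(1,2) by blast
  qed

  obtain x Y where x: "x \<in> (`) e ` sups_in (S j)" and Y: "Y \<in> ?P" "Y \<subseteq> Y0"
    and closed: "\<And>y. y \<in> x \<Longrightarrow> P.dense_below Y (\<lambda>Y. \<exists>z\<in>x. R y z \<and> P.Mem z (P.to_name D) Y)"
    by (rule P.Stationary_imp_closed[OF Y0(1) stationary, of R "P.to_name D"])
      (rule unbounded, assumption+, rule that, assumption+)
  obtain x' b where x': "x = e ` x'" "b \<in> S j" "x' \<subseteq> underS k b" "\<And>a. a \<sqsubset> b \<Longrightarrow> \<exists>c\<in>x'. a \<sqsubseteq> c"
    using x unfolding sups_in_def by blast
  have b: "b \<in> Field k" using x'(2) Sj(2) cof_omega_Field by blast
  let ?Y1 = "Y - {s \<in> A. b \<notin> tr s}"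
  have Y1: "?Y1 \<in> ?P" by (rule positive_Diff[OF ideal Y(1) fine[OF b]])
  \<comment> \<open>As \<open>b \<in> tr s\<close> is not a limit point of \<open>B s\<close>, the part of \<open>B s\<close> below \<open>b\<close> is bounded in \<open>b\<close>; one bound works for a positive set of \<open>s\<close>.\<close>
  have "\<forall>s\<in>?Y1. \<exists>a. a \<sqsubset> b \<and> (\<forall>c\<in>B s. \<not> (a \<sqsubset> c \<and> c \<sqsubset> b))"
  proof
    fix s assume s: "s \<in> ?Y1"
    then have "s \<in> X0" "b \<in> tr s" using Y Y0(2) unfolding positive_sets_def by auto
    then have "\<exists>c\<in>B s. b \<sqsubseteq> c" using B_cofinal by blast
    moreover have "b \<notin> L s" using Y0(3)[of s] s Y(2) x'(2) by blast
    ultimately show "\<exists>a. a \<sqsubset> b \<and> (\<forall>c\<in>B s. \<not> (a \<sqsubset> c \<and> c \<sqsubset> b))" unfolding L_def limit_points_def by blast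
  qed
  from bchoice[OF this] obtain g where g: "\<And>s. s \<in> ?Y1 \<Longrightarrow> g s \<sqsubset> b"
    "\<And>s c. s \<in> ?Y1 \<Longrightarrow> c \<in> B s \<Longrightarrow> \<not> (g s \<sqsubset> c \<and> c \<sqsubset> b)" by blast
  obtain a where a: "a \<sqsubset> b" "{s \<in> ?Y1. g s = a} \<in> ?P"
    using positive_partition[OF I Y1, of g "underS k b"] g(1) card_underS_less[OF b] by blast
  let ?Y2 = "{s \<in> ?Y1. g s = a}"
  \<comment> \<open>Closedness of \<open>x\<close> at \<open>c\<close> yields an element of the generic set strictly between \<open>a\<close> and \<open>b\<close>.\<close>
  obtain c where c: "c \<in> x'" "a \<sqsubseteq> c" using x'(4) a(1) by blast
  have "P.dense_below Y (\<lambda>Y. \<exists>z\<in>x. R (e c) z \<and> P.Mem z (P.to_name D) Y)"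
    by (rule closed) (use c(1) x'(1) in blast)
  from P.dense_belowD[OF P.dense_below_mono[OF this, of ?Y2] a(2)]
  obtain Y3 z where Y3: "Y3 \<in> ?P" "Y3 \<subseteq> ?Y2" "z \<in> x" "R (e c) z" "P.Mem z (P.to_name D) Y3"
    by blast
  obtain c' where c': "c' \<in> x'" "z = e c'" using Y3(3) x'(1) by blast
  have "P.dense_below Y3 (D z)" using Y3(5) unfolding P.Mem_to_name[of D, OF D] .
  from P.dense_belowD[OF this Y3(1)] obtain Y4 where Y4: "Y4 \<in> ?P" "Y4 \<subseteq> Y3" "D z Y4" by blast
  have "Y4 \<noteq> {}" using Y4(1) ideal unfolding positive_sets_def ideal_over_def by blast
  then obtain s where s: "s \<in> Y4" by blast
  have "c' \<in> B s" using Y4(3) s unfolding c'(2) D_e by blast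
  moreover have "s \<in> ?Y1" "g s = a" using s Y4(2) Y3(2) by auto
  moreover have "c \<sqsubset> c'" using Y3(4) unfolding c'(2) R_e .
  then have "a \<sqsubset> c'" using c(2) leq_less_trans by blast
  moreover have "c' \<sqsubset> b" using c'(1) x'(3) by blast
  ultimately show False using g(2) by blast
qed

end

text \<open>
  For an ideal over \<open>\<kappa>\<close> take \<open>tr \<alpha> = \<alpha>\<close>, and over \<open>\<P>\<^sub>\<kappa>\<lambda>\<close> take \<open>tr s = s \<inter> \<kappa>\<close>.
\<close>

theorem theorem6:
  fixes k l :: "'a rel"
  assumes "Card_order k" and "natLeq <o k" and "regularCard k"
    and "Card_order l" and "k initial_segment_of l"
  shows "(\<forall>I. normal_ideal_on_cardinal k I \<and>
            (\<exists>d :: 'a rel. Card_order d \<and> cardSuc d <o k \<and>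
               {a \<in> Field k. has_cofinality k (underS k a) d} \<notin> I) \<longrightarrow>
            \<not> proper_ideal (Field k) I) \<and>
         (\<forall>I. normal_ideal_on_Pkl k l I \<and>
            (\<exists>d :: 'a rel. Card_order d \<and> cardSuc d <o k \<and>
               {s \<in> Pkl k l. has_cofinality l (s \<inter> Field k) d} \<notin> I) \<longrightarrow>
            \<not> proper_ideal (Pkl k l) I)"
proof (intro conjI allI impI; elim conjE exE)
  interpret regular_uncountable k using assms(1-3) by unfold_locales
  {
    fix I and d :: "'a rel"
    assume I: "normal_ideal_on_cardinal k I" and d: "Card_order d" "cardSuc d <o k"
      and pos: "{a \<in> Field k. has_cofinality k (underS k a) d} \<notin> I"
    note normal = I[unfolded normal_ideal_on_cardinal_def]
    show "\<not> proper_ideal (Field k) I"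
    proof (rule not_proper_ideal[where tr = "underS k" and e = "\<lambda>a. {{a}}", OF _ _ _ _ d pos])
      show "complete_ideal k (Field k) I" by (rule conjunct1[OF normal])
      show "underS k s \<subseteq> Field k" for s using less_in_Field by blast
      show "{s \<in> Field k. a \<notin> underS k s} \<in> I" if a: "a \<in> Field k" for a
      proof -
        have "\<forall>b\<in>{s \<in> Field k. a \<notin> underS k s}. b \<sqsubseteq> a" using not_less_iff a by blast
        then show ?thesis
          using a conjunct1[OF conjunct2[OF normal], THEN spec, of "{s \<in> Field k. a \<notin> underS k s}"]
          by blast
      qed
      show "\<exists>Y\<in>positive_sets (Field k) I. Y \<subseteq> X \<and> (\<exists>c. \<forall>s\<in>Y. f s = c)"
        if "X \<in> positive_sets (Field k) I" "\<And>s. s \<in> X \<Longrightarrow> f s \<in> underS k s" for X f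
        using bspec[OF conjunct2[OF conjunct2[OF normal]] that(1), THEN spec, of f] that(2) by blast
      show "inj (\<lambda>a. {{a}})" by (simp add: inj_def)
    qed
  }
  {
    fix I and d :: "'a rel"
    assume I: "normal_ideal_on_Pkl k l I" and d: "Card_order d" "cardSuc d <o k"
      and pos: "{s \<in> Pkl k l. has_cofinality l (s \<inter> Field k) d} \<notin> I"
    note normal = I[unfolded normal_ideal_on_Pkl_def]
    have kl: "(a, b) \<in> k \<longleftrightarrow> (a, b) \<in> l" if "a \<in> Field k" "b \<in> Field k" for a b
      using assms(5) leq_refl[OF that(2)] unfolding init_seg_of_def by blast
    have Fkl: "Field k \<subseteq> Field l"
      using assms(5) mono_Field unfolding init_seg_of_def by blast
    have cof: "cofinal_in l (s \<inter> Field k) C \<longleftrightarrow> cofinal_in k (s \<inter> Field k) C" for s C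
      using kl unfolding cofinal_in_def by blast
    show "\<not> proper_ideal (Pkl k l) I"
    proof (rule not_proper_ideal[where tr = "\<lambda>s. s \<inter> Field k" and e = "\<lambda>a. {{{a}}}", OF _ _ _ _ d])
      show "complete_ideal k (Pkl k l) I" by (rule conjunct1[OF normal])
      show "{s \<in> Pkl k l. has_cofinality k (s \<inter> Field k) d} \<notin> I"
        using pos unfolding has_cofinality_def cof .
      show "{s \<in> Pkl k l. a \<notin> s \<inter> Field k} \<in> I" if a: "a \<in> Field k" for a
      proof -
        have "{s \<in> Pkl k l. a \<notin> s} \<in> I"
          using a Fkl bspec[OF conjunct1[OF conjunct2[OF normal]], of a] by blast
        then show ?thesis using a by simp
      qed
      show "\<exists>Y\<in>positive_sets (Pkl k l) I. Y \<subseteq> X \<and> (\<exists>c. \<forall>s\<in>Y. f s = c)"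
        if "X \<in> positive_sets (Pkl k l) I" "\<And>s. s \<in> X \<Longrightarrow> f s \<in> s \<inter> Field k" for X f
        using bspec[OF conjunct2[OF conjunct2[OF normal]] that(1), THEN spec, of f] that(2) by blast
      show "inj (\<lambda>a. {{{a}}})" by (simp add: inj_def)
    qed blast
  }
qed

end
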